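(* Almost all trees have quantum symmetry: if, for each $n \ge 1$, $T_n$ is drawn uniformly at random from the set of all labelled trees on the vertex set $\{1,\dots,n\}$, then $$\lim_{n\to\infty} \mathbb{P}[\,T_n \text{ has quantum symmetry}\,] = 1.$$
   Context: All graphs are finite, undirected, without loops and without multiple edges; a tree is a connected graph without cycles. A labelled tree on $n$ vertices is a tree with vertex set $\{1,\dots,n\}$ (two labelled trees are equal iff they have the same edge set; there are $n^{n-2}$ of them), and the set of labelled trees on $n$ vertices carries the uniform probability measure. The quantum symmetric group $S_n^+$ is given by the universal unital $C^*$-algebra $$C(S_n^+) = C^*\Big(u_{ij},\ 1\le i,j\le n \ \Big|\ u_{ij}^* = u_{ij}^2 = u_{ij},\ \sum_{k=1}^n u_{ik} = \sum_{k=1}^n u_{kj} = 1 \text{ for all } i,j\Big),$$ with $u=(u_{ij})_{i,j=1}^n$. For a graph $\Gamma$ on vertex set $\{1,\dots,n\}$ with adjacency matrix $A\in M_n(\mathbb{C})$ (so $A_{ij}=1$ if $i,j$ are adjacent, and $0$ otherwise), the quantum automorphism group $\mathrm{QAut}(\Gamma)$ is the compact matrix quantum group with $C^*$-algebra $$C(\mathrm{QAut}(\Gamma)) = C(S_n^+)/\langle uA = Au\rangle,$$ i.e. the quotient of $C(S_n^+)$ by the closed two-sided ideal generated by the entries of $uA-Au$ (equivalently, the universal unital $C^*$-algebra with the generators and relations above together with the relations $\sum_k u_{ik}A_{kj}=\sum_k A_{ik}u_{kj}$ for all $i,j$). The graph $\Gamma$ has quantum symmetry if the inclusion $\mathrm{Aut}(\Gamma)\subseteq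 \mathrm{QAut}(\Gamma)$ is strict, i.e. if and only if the $C^*$-algebra $C(\mathrm{QAut}(\Gamma))$ is non-commutative. *)

theory Defs
  imports "HOL-Probability.Probability" "HOL-Algebra.QuotRing" "HOL-Algebra.Module"
    "HOL-Library.Poly_Mapping"
begin

section \<open>Free unital *-algebras\<close>

datatype 'g letter = Gen 'g | Adj 'g

primrec adj_letter :: "'g letter \<Rightarrow> 'g letter" where
  "adj_letter (Gen g) = Adj g"
| "adj_letter (Adj g) = Gen g"

primrec gen_of :: "'g letter \<Rightarrow> 'g" where
  "gen_of (Gen g) = g"
| "gen_of (Adj g) = g"

text \<open>
  Words in the letters, written additively, so that the product of
  \<^typ>\<open>'a \<Rightarrow>\<^sub>0 'b\<close> becomes the product of noncommutative polynomials.
\<close>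

datatype 'g monomial = Monomial (letters: "'g letter list")

instantiation monomial :: (type) monoid_add
begin

definition zero_monomial :: "'a monomial" where "0 = Monomial []"

definition plus_monomial :: "'a monomial \<Rightarrow> 'a monomial \<Rightarrow> 'a monomial"
  where "v + w = Monomial (letters v @ letters w)"

instance
  by standard (simp_all add: zero_monomial_def plus_monomial_def)

end

type_synonym 'g star_poly = "'g monomial \<Rightarrow>\<^sub>0 complex"

definition gen :: "'g \<Rightarrow> 'g star_poly"
  where "gen g = Poly_Mapping.single (Monomial [Gen g]) 1"

definition scale_poly :: "complex \<Rightarrow> 'g star_poly \<Rightarrow> 'g star_poly"
  where "scale_poly c p = Poly_Mapping.single 0 c * p"

definition adj_monomial :: "'g monomial \<Rightarrow> 'g monomial"
  where "adj_monomial w = Monomial (rev (map adj_letter (letters w)))"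

definition adj_poly :: "'g star_poly \<Rightarrow> 'g star_poly"
  where "adj_poly p =
    (\<Sum>w\<in>Poly_Mapping.keys p. Poly_Mapping.single (adj_monomial w) (cnj (Poly_Mapping.lookup p w)))"

definition star_polys :: "'g set \<Rightarrow> 'g star_poly set"
  where "star_polys G = {p. \<forall>w\<in>Poly_Mapping.keys p. gen_of ` set (letters w) \<subseteq> G}"


section \<open>Universal unital C*-algebras\<close>

definition cstar_seminorm :: "'g set \<Rightarrow> ('g star_poly \<Rightarrow> real) \<Rightarrow> bool"
  where "cstar_seminorm G N \<longleftrightarrow>
    (\<forall>a\<in>star_polys G. 0 \<le> N a) \<and>
    (\<forall>a\<in>star_polys G. \<forall>b\<in>star_polys G. N (a + b) \<le> N a + N b) \<and>
    (\<forall>c. \<forall>a\<in>star_polys G. N (scale_poly c a) = cmod c * N a) \<and>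
    (\<forall>a\<in>star_polys G. \<forall>b\<in>star_polys G. N (a * b) \<le> N a * N b) \<and>
    (\<forall>a\<in>star_polys G. N (adj_poly a * a) = (N a)\<^sup>2)"

text \<open>
  The generators are \<open>G\<close>; a relation is an element of \<open>star_polys G\<close>, understood as being set
  to zero. The supremum below is over a nonempty set (it contains \<open>0\<close>), but it is meaningful only
  if that set is bounded above for every \<open>a\<close>, which is the usual condition for the universal
  C*-algebra to exist. It is satisfied if the relations force the generators to be projections;
  see \<open>bdd_above_cstar_seminorms\<close> below.
\<close>

definition universal_seminorm :: "'g set \<Rightarrow> 'g star_poly set \<Rightarrow> 'g star_poly \<Rightarrow> real"
  where "universal_seminorm G R a =
    (SUP N \<in> {N. cstar_seminorm G N \<and> (\<forall>r\<in>R. N r = 0)}. N a)"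

lemma star_polys_closed [simp]:
  "0 \<in> star_polys G" "1 \<in> star_polys G"
  "a \<in> star_polys G \<Longrightarrow> b \<in> star_polys G \<Longrightarrow> a + b \<in> star_polys G"
  "a \<in> star_polys G \<Longrightarrow> - a \<in> star_polys G"
  "a \<in> star_polys G \<Longrightarrow> b \<in> star_polys G \<Longrightarrow> a - b \<in> star_polys G"
  "a \<in> star_polys G \<Longrightarrow> b \<in> star_polys G \<Longrightarrow> a * b \<in> star_polys G"
  "a \<in> star_polys G \<Longrightarrow> scale_poly c a \<in> star_polys G"
  "a \<in> star_polys G \<Longrightarrow> adj_poly a \<in> star_polys G"
  "g \<in> G \<Longrightarrow> gen g \<in> star_polys G"
proof -
  show "0 \<in> star_polys G" by (simp add: star_polys_def)
  show one: "1 \<in> star_polys G" by (auto simp: star_polys_def zero_monomial_def simp flip: single_one split: if_splits)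
  show add: "a + b \<in> star_polys G" if "a \<in> star_polys G" "b \<in> star_polys G" for a b
    using that Poly_Mapping.keys_add[of a b] by (auto simp: star_polys_def)
  show uminus: "- a \<in> star_polys G" if "a \<in> star_polys G" for a
    using that by (simp add: star_polys_def)
  show "a - b \<in> star_polys G" if "a \<in> star_polys G" "b \<in> star_polys G" for a b
    using add[OF that(1) uminus[OF that(2)]] by simp
  show mult: "a * b \<in> star_polys G" if "a \<in> star_polys G" "b \<in> star_polys G" for a b
    using that Poly_Mapping.keys_mult[of a b] by (fastforce simp: star_polys_def plus_monomial_def)
  show "scale_poly c a \<in> star_polys G" if "a \<in> star_polys G"
    unfolding scale_poly_def using that by (intro mult) (auto simp: star_polys_def zero_monomial_def)
  show "gen g \<in> star_polys G" if "g \<in> G"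
    using that by (simp add: gen_def star_polys_def)
  have [simp]: "gen_of (adj_letter l) = gen_of l" for l :: "'a letter" by (cases l) auto
  have sum: "(\<Sum>w\<in>S. f w) \<in> star_polys G" if "\<And>w. w \<in> S \<Longrightarrow> f w \<in> star_polys G" for S and f :: "'a monomial \<Rightarrow> 'a star_poly"
    using that by (induction S rule: infinite_finite_induct) (simp_all add: add, simp_all add: star_polys_def)
  show "adj_poly a \<in> star_polys G" if "a \<in> star_polys G"
    unfolding adj_poly_def using that
    by (intro sum) (auto simp: star_polys_def adj_monomial_def image_image)
qed

lemma cstar_seminormD:
  assumes "cstar_seminorm G N" "a \<in> star_polys G"
  shows "0 \<le> N a" "b \<in> star_polys G \<Longrightarrow> N (a + b) \<le> N a + N b"
    "N (scale_poly c a) = cmod c * N a" "b \<in> star_polys G \<Longrightarrow> N (a * b) \<le> N a * N b"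
    "N (adj_poly a * a) = (N a)\<^sup>2"
  using assms unfolding cstar_seminorm_def by blast+

lemma scale_simps: "scale_poly 0 a = 0" "scale_poly (-1) a = - a" "scale_poly 1 a = a"
  by (simp_all add: scale_poly_def) (metis single_one single_uminus mult_minus_left mult_1)

lemma adj_one: "adj_poly 1 = 1"
  by (simp add: adj_poly_def adj_monomial_def zero_monomial_def flip: single_one)

lemma seminorm_one:
  assumes "cstar_seminorm G N" shows "N 1 \<le> 1"
proof -
  have "N 1 = (N 1)\<^sup>2" using cstar_seminormD(5)[OF assms, of 1] by (simp add: adj_one)
  then have "N 1 = 0 \<or> N 1 = 1" by (simp add: power2_eq_square)
  then show ?thesis by auto
qed

lemma adj_gen: "adj_poly (gen g) = Poly_Mapping.single (Monomial [Adj g]) 1"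
  by (simp add: adj_poly_def gen_def adj_monomial_def)

lemma seminorm_gen:
  assumes N: "cstar_seminorm G N" and g: "g \<in> G"
    and r: "N (adj_poly (gen g) - gen g) = 0" "N (gen g * gen g - gen g) = 0"
  shows "N (gen g) \<le> 1" "N (adj_poly (gen g)) \<le> 1"
proof -
  note [simp] = g
  let ?g = "gen g"
  have "(N ?g)\<^sup>2 = N ((adj_poly ?g - ?g) * ?g + ((?g * ?g - ?g) + ?g))"
    using cstar_seminormD(5)[OF N, of ?g] by (simp add: algebra_simps)
  also have "\<dots> \<le> N (adj_poly ?g - ?g) * N ?g + (N (?g * ?g - ?g) + N ?g)"
    using cstar_seminormD(2)[OF N, of "(adj_poly ?g - ?g) * ?g" "(?g * ?g - ?g) + ?g"]
      cstar_seminormD(2)[OF N, of "?g * ?g - ?g" ?g]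
      cstar_seminormD(4)[OF N, of "adj_poly ?g - ?g" ?g] by simp
  finally have "N ?g * N ?g \<le> N ?g * 1" using r by (simp add: power2_eq_square)
  moreover have "N ?g \<ge> 0" using cstar_seminormD(1)[OF N] by simp
  ultimately show 1: "N ?g \<le> 1" by (cases "N ?g = 0") auto
  show "N (adj_poly ?g) \<le> 1"
    using cstar_seminormD(2)[OF N, of "adj_poly ?g - ?g" ?g] 1 r by simp
qed

lemma bdd_above_cstar_seminorms:
  assumes R: "\<And>g. g \<in> G \<Longrightarrow> adj_poly (gen g) - gen g \<in> R \<and> gen g * gen g - gen g \<in> R"
    and a: "a \<in> star_polys G"
  shows "bdd_above ((\<lambda>N. N a) ` {N. cstar_seminorm G N \<and> (\<forall>r\<in>R. N r = 0)})"
proof (rule bdd_aboveI2)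
  fix N assume "N \<in> {N. cstar_seminorm G N \<and> (\<forall>r\<in>R. N r = 0)}"
  then have N: "cstar_seminorm G N" and NR: "\<And>r. r \<in> R \<Longrightarrow> N r = 0" by auto
  have letter: "N (Poly_Mapping.single (Monomial [l]) 1) \<le> 1" if "gen_of l \<in> G" for l
    using that seminorm_gen[OF N, of "gen_of l"] R[of "gen_of l"] NR
    by (cases l) (simp_all add: adj_gen, simp_all add: gen_def)
  have word: "N (Poly_Mapping.single (Monomial ls) 1) \<le> 1" if "gen_of ` set ls \<subseteq> G" for ls
    using that
  proof (induction ls)
    case Nil
    then show ?case using seminorm_one[OF N] by (simp flip: single_one add: zero_monomial_def)
  next
    case (Cons l ls)
    let ?x = "Poly_Mapping.single (Monomial [l]) (1::complex)"
    let ?y = "Poly_Mapping.single (Monomial ls) (1::complex)"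
    have eq: "Poly_Mapping.single (Monomial (l # ls)) 1 = ?x * ?y"
      by (simp add: mult_single plus_monomial_def)
    have xy: "?x \<in> star_polys G" "?y \<in> star_polys G" using Cons.prems by (auto simp: star_polys_def)
    then have "N (?x * ?y) \<le> N ?x * N ?y" using cstar_seminormD(4)[OF N] by blast
    also have "\<dots> \<le> 1 * 1"
      using Cons letter[of l] cstar_seminormD(1)[OF N] xy by (intro mult_mono) auto
    finally show ?case by (simp add: eq)
  qed
  have zero: "N 0 = 0" using cstar_seminormD(3)[OF N, of 0 0] by (simp add: scale_simps)
  have sum: "N (\<Sum>w\<in>S. f w) \<le> (\<Sum>w\<in>S. N (f w))" if "finite S" "\<And>w. w \<in> S \<Longrightarrow> f w \<in> star_polys G"
    for S and f :: "'a monomial \<Rightarrow> 'a star_poly"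
    using that
  proof (induction S)
    case (insert w S)
    have "sum f S \<in> star_polys G"
      using insert(1,4) by (induction S) (auto intro: star_polys_closed)
    then show ?case using insert cstar_seminormD(2)[OF N, of "f w" "sum f S"] by force
  qed (simp add: zero)
  have single: "N (Poly_Mapping.single w c) \<le> cmod c" if "gen_of ` set (letters w) \<subseteq> G" for w c
  proof -
    have eq: "Poly_Mapping.single w c = scale_poly c (Poly_Mapping.single w 1)"
      by (simp add: scale_poly_def mult_single)
    have "Poly_Mapping.single w 1 \<in> star_polys G" using that by (simp add: star_polys_def)
    moreover have "N (Poly_Mapping.single w 1) \<le> 1" using word[OF that] by simp
    ultimately show ?thesis
      unfolding eq by (simp add: cstar_seminormD(3)[OF N] mult_left_le)
  qed
  have "N a = N (\<Sum>w\<in>Poly_Mapping.keys a. Poly_Mapping.single w (Poly_Mapping.lookup a w))"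
  proof (rule arg_cong[of _ _ N], rule poly_mapping_eqI)
    have l: "Poly_Mapping.lookup (\<Sum>w\<in>S. Poly_Mapping.single w (c w)) v = (if v \<in> S then c v else 0)"
      if "finite S" for v and c :: "'a monomial \<Rightarrow> complex" and S
      using that by (induction S) (auto simp: lookup_add lookup_single when_def)
    fix v
    show "Poly_Mapping.lookup a v = Poly_Mapping.lookup
      (\<Sum>w\<in>Poly_Mapping.keys a. Poly_Mapping.single w (Poly_Mapping.lookup a w)) v"
      by (simp add: l in_keys_iff)
  qed
  also have "\<dots> \<le> (\<Sum>w\<in>Poly_Mapping.keys a. N (Poly_Mapping.single w (Poly_Mapping.lookup a w)))"
    using a by (intro sum) (auto simp: star_polys_def)
  also have "\<dots> \<le> (\<Sum>w\<in>Poly_Mapping.keys a. cmod (Poly_Mapping.lookup a w))"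
    using a by (intro sum_mono single) (auto simp: star_polys_def)
  finally show "N a \<le> (\<Sum>w\<in>Poly_Mapping.keys a. cmod (Poly_Mapping.lookup a w))" .
qed


lemma universal_seminorm_properties:
  assumes "\<forall>a\<in>star_polys G. bdd_above ((\<lambda>N. N a) ` {N. cstar_seminorm G N \<and> (\<forall>r\<in>R. N r = 0)})"
  shows "cstar_seminorm G (universal_seminorm G R)"
    and "r \<in> R \<Longrightarrow> universal_seminorm G R r = 0"
    and "cstar_seminorm G N \<Longrightarrow> (\<forall>r\<in>R. N r = 0) \<Longrightarrow> a \<in> star_polys G \<Longrightarrow> N a \<le> universal_seminorm G R a"
proof -
  define P where "P = {N. cstar_seminorm G N \<and> (\<forall>r\<in>R. N r = 0)}"
  define S where "S = universal_seminorm G R"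
  have S: "S a = (SUP N\<in>P. N a)" for a by (simp add: S_def P_def universal_seminorm_def)
  have P0: "(\<lambda>_. 0) \<in> P" by (simp add: P_def cstar_seminorm_def)
  then have ne: "P \<noteq> {}" by blast
  have P: "cstar_seminorm G N" if "N \<in> P" for N using that by (simp add: P_def)
  have up: "N a \<le> S a" if "N \<in> P" "a \<in> star_polys G" for N a
    using assms that unfolding S P_def[symmetric] by (intro cSUP_upper) auto
  have least: "S a \<le> c" if "\<And>N. N \<in> P \<Longrightarrow> N a \<le> c" for a c
    unfolding S using ne that by (intro cSUP_least)
  have pos: "0 \<le> S a" if "a \<in> star_polys G" for a using up[OF P0 that] .
  show "universal_seminorm G R r = 0" if "r \<in> R"
  proof -
    have "S r = (SUP N\<in>P. 0)" unfolding S using that by (intro SUP_cong) (auto simp: P_def)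
    then show ?thesis using ne by (simp add: S_def)
  qed
  show "N a \<le> universal_seminorm G R a" if "cstar_seminorm G N" "\<forall>r\<in>R. N r = 0" "a \<in> star_polys G"
    using up[of N a] that by (simp add: P_def S_def)
  have le: "S (scale_poly c a) \<le> cmod c * S a" if "a \<in> star_polys G" for c a
    using that cstar_seminormD(3)[OF P] up by (intro least) (metis mult_left_mono norm_ge_zero)
  have "S (scale_poly c a) = cmod c * S a" if a: "a \<in> star_polys G" for c a
  proof (cases "c = 0")
    case True
    then show ?thesis using le[OF a, of c] pos[of "scale_poly c a"] a by simp
  next
    case False
    have "scale_poly (inverse c) (scale_poly c a) = a"
      using False by (simp add: scale_poly_def mult_single flip: mult.assoc)
    then have "S a \<le> cmod (inverse c) * S (scale_poly c a)"
      using le[of "scale_poly c a" "inverse c"] a by simp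
    then have "cmod c * S a \<le> S (scale_poly c a)"
      using False by (simp add: norm_divide field_simps)
    then show ?thesis using le[OF a, of c] by simp
  qed
  moreover have "S (a + b) \<le> S a + S b" if "a \<in> star_polys G" "b \<in> star_polys G" for a b
    using that cstar_seminormD(2)[OF P] up by (intro least) (meson add_mono order_trans)
  moreover have "S (a * b) \<le> S a * S b" if "a \<in> star_polys G" "b \<in> star_polys G" for a b
    using that cstar_seminormD(4)[OF P] cstar_seminormD(1)[OF P] up pos
    by (intro least) (meson mult_mono order_trans)
  moreover have "S (adj_poly a * a) = (S a)\<^sup>2" if a: "a \<in> star_polys G" for a
  proof (rule antisym)
    show "S (adj_poly a * a) \<le> (S a)\<^sup>2"
      using a cstar_seminormD(5)[OF P a] cstar_seminormD(1)[OF P a] up by (intro least) (metis power_mono)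
    have "S a \<le> sqrt (S (adj_poly a * a))"
    proof (rule least)
      fix N assume N: "N \<in> P"
      have "(N a)\<^sup>2 \<le> S (adj_poly a * a)"
        using up[OF N, of "adj_poly a * a"] a cstar_seminormD(5)[OF P[OF N] a] by simp
      then show "N a \<le> sqrt (S (adj_poly a * a))" by (rule real_le_rsqrt)
    qed
    then have "(S a)\<^sup>2 \<le> (sqrt (S (adj_poly a * a)))\<^sup>2" using pos[OF a] by (rule power_mono)
    then show "(S a)\<^sup>2 \<le> S (adj_poly a * a)" using pos[of "adj_poly a * a"] a by simp
  qed
  ultimately show "cstar_seminorm G (universal_seminorm G R)"
    unfolding cstar_seminorm_def S_def[symmetric] using pos by blast
qed

definition cauchy_ring :: "'g set \<Rightarrow> 'g star_poly set \<Rightarrow> (nat \<Rightarrow> 'g star_poly) ring"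
  where "cauchy_ring G R =
    \<lparr>carrier = {x. (\<forall>n. x n \<in> star_polys G) \<and>
       (\<forall>e>0. \<exists>M. \<forall>m\<ge>M. \<forall>n\<ge>M. universal_seminorm G R (x m - x n) < e)},
     mult = (\<lambda>x y n. x n * y n),
     one = (\<lambda>n. 1),
     zero = (\<lambda>n. 0),
     add = (\<lambda>x y n. x n + y n)\<rparr>"

definition null_sequences :: "'g set \<Rightarrow> 'g star_poly set \<Rightarrow> (nat \<Rightarrow> 'g star_poly) set"
  where "null_sequences G R =
    {x. (\<forall>n. x n \<in> star_polys G) \<and> (\<lambda>n. universal_seminorm G R (x n)) \<longlonglongrightarrow> 0}"

record 'a cstar_algebra = "(complex, 'a) module" +
  involution :: "'a \<Rightarrow> 'a"
  cstar_norm :: "'a \<Rightarrow> real"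

text \<open>
  The Hausdorff completion of \<open>star_polys G\<close> for the universal seminorm, as Cauchy sequences modulo
  null sequences.
\<close>

definition universal_cstar_algebra ::
    "'g set \<Rightarrow> 'g star_poly set \<Rightarrow> (nat \<Rightarrow> 'g star_poly) set cstar_algebra"
  where "universal_cstar_algebra G R =
    (let C = cauchy_ring G R; I = null_sequences G R; Q = FactRing C I in
     \<lparr>carrier = carrier Q,
      mult = mult Q,
      one = one Q,
      zero = zero Q,
      add = add Q,
      smult = (\<lambda>c X. \<Union>x\<in>X. I +>\<^bsub>C\<^esub> (\<lambda>n. scale_poly c (x n))),
      involution = (\<lambda>X. \<Union>x\<in>X. I +>\<^bsub>C\<^esub> (\<lambda>n. adj_poly (x n))),
      cstar_norm = (\<lambda>X. the_elem ((\<lambda>x. lim (\<lambda>n. universal_seminorm G R (x n))) ` X))\<rparr>)"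

definition commutative_algebra :: "('a, 'b) ring_scheme \<Rightarrow> bool"
  where "commutative_algebra A \<longleftrightarrow>
    (\<forall>x\<in>carrier A. \<forall>y\<in>carrier A. x \<otimes>\<^bsub>A\<^esub> y = y \<otimes>\<^bsub>A\<^esub> x)"


section \<open>Quantum automorphism groups of graphs\<close>

text \<open>A graph on \<open>{1..n}\<close> is given by its set of edges, each of which is a two-element set.\<close>

definition simple_graph :: "nat \<Rightarrow> nat set set \<Rightarrow> bool"
  where "simple_graph n E \<longleftrightarrow> E \<subseteq> {e. e \<subseteq> {1..n} \<and> card e = 2}"

definition adjacency :: "nat set set \<Rightarrow> nat \<Rightarrow> nat \<Rightarrow> complex"
  where "adjacency E i j = (if {i, j} \<in> E then 1 else 0)"

text \<open>The generator \<open>gen (i, j)\<close> is the matrix entry \<open>u\<^sub>i\<^sub>j\<close>.\<close>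

definition magic_unitary_relations :: "nat \<Rightarrow> (nat \<times> nat) star_poly set"
  where "magic_unitary_relations n =
    {adj_poly (gen (i, j)) - gen (i, j) | i j. i \<in> {1..n} \<and> j \<in> {1..n}} \<union>
    {gen (i, j) * gen (i, j) - gen (i, j) | i j. i \<in> {1..n} \<and> j \<in> {1..n}} \<union>
    {(\<Sum>k=1..n. gen (i, k)) - 1 | i. i \<in> {1..n}} \<union>
    {(\<Sum>k=1..n. gen (k, j)) - 1 | j. j \<in> {1..n}}"

definition commutation_relations :: "nat \<Rightarrow> (nat \<Rightarrow> nat \<Rightarrow> complex) \<Rightarrow> (nat \<times> nat) star_poly set"
  where "commutation_relations n A =
    {(\<Sum>k=1..n. scale_poly (A k j) (gen (i, k))) - (\<Sum>k=1..n. scale_poly (A i k) (gen (k, j))) | i j.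
       i \<in> {1..n} \<and> j \<in> {1..n}}"

definition C_QAut ::
    "nat \<Rightarrow> nat set set \<Rightarrow> (nat \<Rightarrow> (nat \<times> nat) star_poly) set cstar_algebra"
  where "C_QAut n E = universal_cstar_algebra ({1..n} \<times> {1..n})
    (magic_unitary_relations n \<union> commutation_relations n (adjacency E))"

text \<open>
  Strictness of the inclusion of the automorphism group in the quantum automorphism group means
  noncommutativity of this C*-algebra.
\<close>

definition has_quantum_symmetry :: "nat \<Rightarrow> nat set set \<Rightarrow> bool"
  where "has_quantum_symmetry n E \<longleftrightarrow> \<not> commutative_algebra (C_QAut n E)"

lemma C_QAut_bdd_above:
  assumes "a \<in> star_polys ({1..n} \<times> {1..n})"
  shows "bdd_above ((\<lambda>N. N a) ` {N. cstar_seminorm ({1..n} \<times> {1..n}) N \<and>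
    (\<forall>r \<in> magic_unitary_relations n \<union> commutation_relations n A. N r = 0)})"
proof (rule bdd_above_cstar_seminorms[OF _ assms])
  fix g assume "g \<in> {1..n} \<times> {1..n}"
  then obtain i j where "g = (i, j)" "i \<in> {1..n}" "j \<in> {1..n}" by blast
  then show "adj_poly (gen g) - gen g \<in> magic_unitary_relations n \<union> commutation_relations n A \<and>
      gen g * gen g - gen g \<in> magic_unitary_relations n \<union> commutation_relations n A"
    unfolding magic_unitary_relations_def by blast
qed


section \<open>Labelled trees\<close>

definition connected_graph :: "nat \<Rightarrow> nat set set \<Rightarrow> bool"
  where "connected_graph n E \<longleftrightarrow>
    (\<forall>i\<in>{1..n}. \<forall>j\<in>{1..n}. (i, j) \<in> {(v, w). {v, w} \<in> E}\<^sup>*)"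

definition has_cycle :: "nat set set \<Rightarrow> bool"
  where "has_cycle E \<longleftrightarrow>
    (\<exists>vs. distinct vs \<and> length vs \<ge> 3 \<and>
       (\<forall>i<length vs. {vs ! i, vs ! (Suc i mod length vs)} \<in> E))"

definition labelled_trees :: "nat \<Rightarrow> nat set set set"
  where "labelled_trees n = {E. simple_graph n E \<and> connected_graph n E \<and> \<not> has_cycle E}"

end

theory Submission
  imports Defs "HOL-Real_Asymp.Real_Asymp"
begin

text \<open>
  Call two leaves of a tree twins if they hang on the same vertex. Exchanging two twins is an
  automorphism, and a tree with two disjoint pairs of twins \<open>{a, b}\<close> and \<open>{c, d}\<close> has two
  automorphisms with disjoint supports. Each of the two can be deformed independently: for
  orthogonal projections \<open>P\<close> and \<open>Q\<close>, the matrix with diagonal blocks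
  \<open>(P, 1 - P; 1 - P, P)\<close> on \<open>{a, b}\<close>, \<open>(Q, 1 - Q; 1 - Q, Q)\<close> on \<open>{c, d}\<close> and the identity elsewhere
  is a magic unitary. Its nonzero entries only connect vertices with the same neighbours, so it
  commutes with the adjacency matrix. With two projections of \<open>\<complex>\<^sup>2\<close> that do not commute, this is a
  representation of the quantum automorphism algebra with noncommutative image; composed with the
  operator norm it is a C*-seminorm that is bounded by the universal one and does not vanish on a
  commutator. This is \<open>quantum_symmetry_of_disjoint_twins\<close>.

  It remains to show that a random tree has two disjoint pairs of twins with high probability. All
  counting rests on \<open>card_trees_pendant_family\<close>: deleting a set \<open>S\<close> of leaves with prescribed
  neighbours outside \<open>S\<close> is a bijection onto the trees on the remaining vertices. As every tree with
  at least two vertices has a leaf, inclusion-exclusion over the set of leaves turns this into a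
  recursion that determines the number of trees, which gives Cayley's formula \<open>n ^ (n - 2)\<close>. The same
  bijection then counts the trees in which given pairs are twins, and so yields the mean and a bound
  for the second moment of the number of ordered pairs of twins. The mean grows like
  \<open>n / exp 2\<close>, and the second moment is asymptotic to its square, so by Chebyshev's inequality
  almost all trees have more than nine ordered pairs of twins. Being twins is a transitive relation, so
  without two disjoint pairs all twins would lie in a set of three vertices, and there would be at most
  nine pairs.
\<close>

section \<open>Operators on a two-dimensional Hilbert space\<close>

type_synonym qubit = "complex \<times> complex"

definition cscale :: "complex \<Rightarrow> qubit \<Rightarrow> qubit"
  where "cscale c x = (c * fst x, c * snd x)"

lemma cscale_simps [simp]:
  "cscale 0 x = 0" "cscale 1 x = x" "cscale c 0 = 0"
  "cscale c (x + y) = cscale c x + cscale c y"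
  "cscale (c + d) x = cscale c x + cscale d x"
  "cscale c (cscale d x) = cscale (c * d) x"
  by (simp_all add: cscale_def prod_eq_iff algebra_simps)

lemma cscale_sum: "cscale c (\<Sum>i\<in>I. f i) = (\<Sum>i\<in>I. cscale c (f i))"
  by (induction I rule: infinite_finite_induct) simp_all

lemma norm_cscale: "norm (cscale c x) = cmod c * norm x"
  by (simp add: cscale_def norm_prod_def norm_mult power_mult_distrib real_sqrt_mult
      flip: distrib_left)

lemma bounded_linear_cscale: "bounded_linear (cscale c)"
  by (rule bounded_linear_intro[where K = "cmod c"])
    (simp_all add: norm_cscale mult.commute, simp add: cscale_def scaleR_prod_def prod_eq_iff)

lemma inner_cscale_left: "inner (cscale c x) y = inner x (cscale (cnj c) y)"
  by (simp add: cscale_def inner_prod_def inner_complex_def algebra_simps)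

definition word_op :: "('g \<Rightarrow> qubit \<Rightarrow> qubit) \<Rightarrow> 'g monomial \<Rightarrow> qubit \<Rightarrow> qubit"
  where "word_op U w = foldr (\<lambda>l f. U (gen_of l) \<circ> f) (letters w) id"

definition rep :: "('g \<Rightarrow> qubit \<Rightarrow> qubit) \<Rightarrow> 'g star_poly \<Rightarrow> qubit \<Rightarrow> qubit"
  where "rep U p x =
    (\<Sum>w\<in>Poly_Mapping.keys p. cscale (Poly_Mapping.lookup p w) (word_op U w x))"

text \<open>
  A family of self-adjoint operators extends uniquely to a *-representation of the free *-algebra;
  a generator and its formal adjoint act by the same operator.
\<close>

locale self_adjoint_family =
  fixes U :: "'g \<Rightarrow> qubit \<Rightarrow> qubit"
  assumes bounded_linear_U: "bounded_linear (U g)"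
    and U_cscale: "U g (cscale c x) = cscale c (U g x)"
    and U_self_adjoint: "inner (U g x) y = inner x (U g y)"
begin

lemma word_op_Cons: "word_op U (Monomial (l # ls)) x = U (gen_of l) (word_op U (Monomial ls) x)"
  by (simp add: word_op_def)

lemma word_op_plus: "word_op U (v + w) x = word_op U v (word_op U w x)"
proof -
  have "foldr (\<lambda>l f. U (gen_of l) \<circ> f) (ls @ ks) id x
      = foldr (\<lambda>l f. U (gen_of l) \<circ> f) ls id (foldr (\<lambda>l f. U (gen_of l) \<circ> f) ks id x)" for ls ks
    by (induction ls) simp_all
  then show ?thesis by (simp add: word_op_def plus_monomial_def)
qed

lemma bounded_linear_word_op: "bounded_linear (word_op U w)"
proof -
  have "bounded_linear (foldr (\<lambda>l f. U (gen_of l) \<circ> f) ls id)" for ls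
    by (induction ls)
      (auto simp: id_def o_def intro: bounded_linear_ident bounded_linear_compose[OF bounded_linear_U])
  then show ?thesis by (simp add: word_op_def)
qed

lemma word_op_cscale: "word_op U w (cscale c x) = cscale c (word_op U w x)"
proof -
  have "foldr (\<lambda>l f. U (gen_of l) \<circ> f) ls id (cscale c x)
    = cscale c (foldr (\<lambda>l f. U (gen_of l) \<circ> f) ls id x)" for ls
    by (induction ls) (simp_all add: U_cscale)
  then show ?thesis by (simp add: word_op_def)
qed

lemma word_op_adj: "inner (word_op U (adj_monomial w) x) y = inner x (word_op U w y)"
proof -
  have gen_adj: "gen_of (adj_letter l) = gen_of l" for l :: "'g letter" by (cases l) auto
  have "inner (word_op U (adj_monomial (Monomial ls)) x) y = inner x (word_op U (Monomial ls) y)"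
    for ls x
  proof (induction ls arbitrary: x)
    case Nil
    then show ?case by (simp add: word_op_def adj_monomial_def)
  next
    case (Cons l ls)
    have "adj_monomial (Monomial (l # ls)) = adj_monomial (Monomial ls) + Monomial [adj_letter l]"
      by (simp add: adj_monomial_def plus_monomial_def)
    then have "inner (word_op U (adj_monomial (Monomial (l # ls))) x) y
        = inner (word_op U (adj_monomial (Monomial ls)) (U (gen_of l) x)) y"
      by (simp add: word_op_plus gen_adj) (simp add: word_op_def gen_adj)
    then show ?case by (simp add: Cons.IH U_self_adjoint word_op_Cons)
  qed
  then show ?thesis by (metis monomial.exhaust)
qed

lemma rep_superset:
  assumes "finite W" "Poly_Mapping.keys p \<subseteq> W"
  shows "rep U p x = (\<Sum>w\<in>W. cscale (Poly_Mapping.lookup p w) (word_op U w x))"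
  unfolding rep_def using assms by (intro sum.mono_neutral_left) (auto simp: in_keys_iff)

lemma rep_single: "rep U (Poly_Mapping.single w c) x = cscale c (word_op U w x)"
  by (subst rep_superset[of "{w}"]) auto

lemma rep_zero [simp]: "rep U 0 x = 0"
  by (simp add: rep_def)

lemma rep_gen [simp]: "rep U (gen g) x = U g x"
  by (simp add: gen_def rep_single word_op_def)

lemma rep_one [simp]: "rep U 1 x = x"
  by (simp add: rep_single word_op_def zero_monomial_def flip: single_one)

lemma rep_add: "rep U (p + q) x = rep U p x + rep U q x"
proof -
  let ?W = "Poly_Mapping.keys p \<union> Poly_Mapping.keys q"
  show ?thesis
    using Poly_Mapping.keys_add[of p q]
    by (simp add: rep_superset[of ?W] lookup_add sum.distrib)
qed

lemma rep_sum: "rep U (\<Sum>i\<in>I. f i) x = (\<Sum>i\<in>I. rep U (f i) x)"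
  by (induction I rule: infinite_finite_induct) (simp_all add: rep_add)

lemma rep_diff: "rep U (p - q) x = rep U p x - rep U q x"
  using rep_add[of "p - q" q x] by (simp add: algebra_simps)

lemma bounded_linear_rep: "bounded_linear (rep U p)"
  unfolding rep_def
  by (intro bounded_linear_sum bounded_linear_compose[OF bounded_linear_cscale]
      bounded_linear_word_op)

lemma rep_sum_arg: "rep U p (\<Sum>i\<in>I. f i) = (\<Sum>i\<in>I. rep U p (f i))"
  by (rule linear_sum[OF bounded_linear.linear[OF bounded_linear_rep]])

lemma poly_eq_sum_single:
  "p = (\<Sum>w\<in>Poly_Mapping.keys p. Poly_Mapping.single w (Poly_Mapping.lookup p w))"
  by (rule poly_mapping_eqI)
    (simp add: lookup_sum lookup_single when_def in_keys_iff if_distrib cong: if_cong)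

lemma rep_mult: "rep U (p * q) x = rep U p (rep U q x)"
proof -
  let ?s = "\<lambda>p w. Poly_Mapping.single w (Poly_Mapping.lookup p w)"
  have single: "rep U (Poly_Mapping.single v c * Poly_Mapping.single w d) x =
      rep U (Poly_Mapping.single v c) (rep U (Poly_Mapping.single w d) x)" for v w c d
    by (simp add: mult_single rep_single word_op_plus word_op_cscale)
  have "rep U (p * q) x
      = rep U ((\<Sum>v\<in>Poly_Mapping.keys p. ?s p v) * (\<Sum>w\<in>Poly_Mapping.keys q. ?s q w)) x"
    using poly_eq_sum_single[of p] poly_eq_sum_single[of q] by simp
  also have "\<dots> = (\<Sum>v\<in>Poly_Mapping.keys p. \<Sum>w\<in>Poly_Mapping.keys q. rep U (?s p v) (rep U (?s q w) x))"
    by (simp add: sum_product rep_sum single)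
  also have "\<dots> = rep U (\<Sum>v\<in>Poly_Mapping.keys p. ?s p v)
      (rep U (\<Sum>w\<in>Poly_Mapping.keys q. ?s q w) x)"
    unfolding rep_sum rep_sum_arg by (rule sum.swap)
  also have "\<dots> = rep U p (rep U q x)"
    by (simp flip: poly_eq_sum_single)
  finally show ?thesis .
qed

lemma rep_scale_poly: "rep U (scale_poly c p) x = cscale c (rep U p x)"
  by (simp add: scale_poly_def rep_mult rep_single word_op_def zero_monomial_def)

text \<open>
  The real inner product is enough here: it is the real part of the hermitian one and has the same
  adjoints among complex linear operators.
\<close>

lemma rep_adj: "inner (rep U (adj_poly p) x) y = inner x (rep U p y)"
proof -
  have "inner (rep U (adj_poly p) x) y =
      (\<Sum>w\<in>Poly_Mapping.keys p. inner x (cscale (Poly_Mapping.lookup p w) (word_op U w y)))"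
    unfolding adj_poly_def rep_sum
    by (simp add: rep_single inner_sum_left inner_cscale_left word_op_adj word_op_cscale)
  then show ?thesis by (simp add: rep_def inner_sum_right)
qed

lemma onorm_rep_adj_le: "onorm (rep U (adj_poly p)) \<le> onorm (rep U p)"
proof (rule onorm_le)
  fix x
  let ?y = "rep U (adj_poly p) x"
  have "(norm ?y)\<^sup>2 = inner x (rep U p ?y)"
    by (simp add: power2_norm_eq_inner rep_adj)
  also have "\<dots> \<le> norm x * (onorm (rep U p) * norm ?y)"
    by (rule order_trans[OF norm_cauchy_schwarz])
      (simp add: mult_left_mono onorm[OF bounded_linear_rep])
  finally have "norm ?y * norm ?y \<le> (onorm (rep U p) * norm x) * norm ?y"
    by (simp add: power2_eq_square mult_ac)
  then show "norm ?y \<le> onorm (rep U p) * norm x"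
    using onorm_pos_le[OF bounded_linear_rep, of p] by (cases "norm ?y = 0") auto
qed

lemma onorm_rep_cstar_identity: "onorm (rep U (adj_poly p * p)) = (onorm (rep U p))\<^sup>2"
proof (rule antisym)
  have comp: "rep U (adj_poly p * p) = rep U (adj_poly p) \<circ> rep U p"
    by (simp add: fun_eq_iff rep_mult)
  have "onorm (rep U (adj_poly p * p)) \<le> onorm (rep U (adj_poly p)) * onorm (rep U p)"
    unfolding comp by (rule onorm_compose[OF bounded_linear_rep bounded_linear_rep])
  also have "\<dots> \<le> onorm (rep U p) * onorm (rep U p)"
    by (intro mult_right_mono onorm_rep_adj_le onorm_pos_le[OF bounded_linear_rep])
  finally show "onorm (rep U (adj_poly p * p)) \<le> (onorm (rep U p))\<^sup>2"
    by (simp add: power2_eq_square)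
  let ?k = "onorm (rep U (adj_poly p * p))"
  have k: "0 \<le> ?k" by (rule onorm_pos_le[OF bounded_linear_rep])
  have "onorm (rep U p) \<le> sqrt ?k"
  proof (rule onorm_le)
    fix x
    have "(norm (rep U p x))\<^sup>2 = inner (rep U (adj_poly p * p) x) x"
      by (simp add: power2_norm_eq_inner rep_mult rep_adj)
    also have "\<dots> \<le> ?k * norm x * norm x"
      by (rule order_trans[OF norm_cauchy_schwarz])
        (simp add: mult_right_mono onorm[OF bounded_linear_rep])
    also have "\<dots> = (sqrt ?k * norm x)\<^sup>2"
      using k by (simp add: power2_eq_square)
    finally show "norm (rep U p x) \<le> sqrt ?k * norm x"
      by (rule power2_le_imp_le) (use k in simp)
  qed
  then have "(onorm (rep U p))\<^sup>2 \<le> (sqrt ?k)\<^sup>2"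
    by (rule power_mono) (rule onorm_pos_le[OF bounded_linear_rep])
  then show "(onorm (rep U p))\<^sup>2 \<le> ?k"
    using k by simp
qed

lemma onorm_cscale_rep: "onorm (\<lambda>x. cscale c (rep U p x)) = cmod c * onorm (rep U p)"
proof -
  have le: "onorm (\<lambda>x. cscale c (f x)) \<le> cmod c * onorm f" if "bounded_linear f"
    for c and f :: "qubit \<Rightarrow> qubit"
    by (rule onorm_le) (simp add: norm_cscale mult.assoc mult_left_mono onorm[OF that])
  have "cmod c * onorm (rep U p) \<le> onorm (\<lambda>x. cscale c (rep U p x))" if "c \<noteq> 0"
  proof -
    have "onorm (rep U p) = onorm (\<lambda>x. cscale (inverse c) (cscale c (rep U p x)))"
      using that by simp
    also have "\<dots> \<le> cmod (inverse c) * onorm (\<lambda>x. cscale c (rep U p x))"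
      by (intro le bounded_linear_compose[OF bounded_linear_cscale] bounded_linear_rep)
    finally show ?thesis using that by (simp add: norm_inverse norm_divide field_simps)
  qed
  then show ?thesis
    using le[OF bounded_linear_rep, of c p] by (cases "c = 0") (auto simp: onorm_zero)
qed

text \<open>
  Operators on a Hilbert space satisfy the C*-identity, so every *-representation that
  kills the relations is a competitor in the supremum that defines the universal seminorm.
\<close>

lemma cstar_seminorm_onorm_rep: "cstar_seminorm G (\<lambda>p. onorm (rep U p))"
  unfolding cstar_seminorm_def
proof (intro conjI ballI allI)
  fix p q :: "'g star_poly" and c
  show "0 \<le> onorm (rep U p)" by (rule onorm_pos_le[OF bounded_linear_rep])
  show "onorm (rep U (p + q)) \<le> onorm (rep U p) + onorm (rep U q)"
    using onorm_triangle[OF bounded_linear_rep bounded_linear_rep, of p q]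
    by (simp add: rep_add[abs_def])
  show "onorm (rep U (scale_poly c p)) = cmod c * onorm (rep U p)"
    using onorm_cscale_rep[of c p] by (simp add: rep_scale_poly[abs_def])
  show "onorm (rep U (p * q)) \<le> onorm (rep U p) * onorm (rep U q)"
    using onorm_compose[OF bounded_linear_rep bounded_linear_rep, of p q]
    by (simp add: rep_mult[abs_def] o_def)
  show "onorm (rep U (adj_poly p * p)) = (onorm (rep U p))\<^sup>2"
    by (rule onorm_rep_cstar_identity)
qed

end


section \<open>Noncommutativity of the completed algebra\<close>

text \<open>
  With products unfolded to representatives up to a null sequence, commutativity can be tested without
  the ring structure of the Cauchy sequences.
\<close>

lemma mult_FactRing_cauchy_ring:
  "mult (FactRing (cauchy_ring G R) I) X Y =
    {z. \<exists>i\<in>I. \<exists>x\<in>X. \<exists>y\<in>Y. z = (\<lambda>n. i n + x n * y n)}"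
  by (auto simp: FactRing_def rcoset_mult_def a_r_coset_def r_coset_def cauchy_ring_def)

lemma seminorm_tendsto_zero:
  assumes N: "cstar_seminorm G N" "\<forall>r\<in>R. N r = 0"
    and bdd: "\<forall>a\<in>star_polys G. bdd_above ((\<lambda>N. N a) ` {N. cstar_seminorm G N \<and> (\<forall>r\<in>R. N r = 0)})"
    and i: "i \<in> null_sequences G R"
  shows "(\<lambda>n. N (i n)) \<longlonglongrightarrow> 0"
proof (rule tendsto_sandwich)
  show "\<forall>\<^sub>F n in sequentially. 0 \<le> N (i n)"
    using i cstar_seminormD(1)[OF N(1)] by (auto simp: null_sequences_def)
  show "\<forall>\<^sub>F n in sequentially. N (i n) \<le> universal_seminorm G R (i n)"
    using i universal_seminorm_properties(3)[OF bdd N(1,2)] by (auto simp: null_sequences_def)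
  show "(\<lambda>n. universal_seminorm G R (i n)) \<longlonglongrightarrow> 0"
    using i by (simp add: null_sequences_def)
qed simp

text \<open>
  If the classes of \<open>a\<close> and \<open>b\<close> commute, then \<open>a b\<close> differs from a product of
  representatives \<open>j + b\<close> and \<open>k + a\<close> by a null sequence. Null sequences for the universal seminorm
  are null sequences for each smaller seminorm \<open>N\<close>, so \<open>N\<close> vanishes on the commutator.
\<close>

lemma not_commutative_if_seminorm_commutator:
  assumes N: "cstar_seminorm G N" "\<forall>r\<in>R. N r = 0"
    and bdd: "\<forall>a\<in>star_polys G. bdd_above ((\<lambda>N. N a) ` {N. cstar_seminorm G N \<and> (\<forall>r\<in>R. N r = 0)})"
    and ab: "a \<in> star_polys G" "b \<in> star_polys G"
    and pos: "N (a * b - b * a) > 0"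
  shows "\<not> commutative_algebra (universal_cstar_algebra G R)"
proof
  define I where "I = null_sequences G R"
  define S where "S = universal_seminorm G R"
  define Q where "Q = FactRing (cauchy_ring G R) I"
  define cl where "cl p = {\<lambda>n. i n + p | i. i \<in> I}" for p
  note univ = universal_seminorm_properties[OF bdd]
  have S0: "S 0 = 0"
    using cstar_seminormD(3)[OF univ(1), of 0 0] by (simp add: scale_simps S_def)
  have I0: "(\<lambda>_. 0) \<in> I"
    using S0 by (simp add: I_def null_sequences_def S_def)
  have carrier: "cl p \<in> carrier Q" if "p \<in> star_polys G" for p
  proof -
    have "(\<lambda>_. p) \<in> carrier (cauchy_ring G R)"
      using that S0 by (simp add: cauchy_ring_def S_def)
    moreover have "cl p = a_r_coset (cauchy_ring G R) I (\<lambda>_. p)"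
      by (auto simp: cl_def a_r_coset_def r_coset_def cauchy_ring_def)
    ultimately show ?thesis
      by (auto simp: Q_def FactRing_def A_RCOSETS_def RCOSETS_def a_r_coset_def)
  qed
  have self: "(\<lambda>_. p) \<in> cl p" for p
    unfolding cl_def using I0 by force
  assume "commutative_algebra (universal_cstar_algebra G R)"
  then have "mult Q (cl a) (cl b) = mult Q (cl b) (cl a)"
    using carrier[OF ab(1)] carrier[OF ab(2)]
    by (simp add: commutative_algebra_def universal_cstar_algebra_def Let_def Q_def I_def)
  moreover have "(\<lambda>n. a * b) \<in> mult Q (cl a) (cl b)"
    unfolding Q_def mult_FactRing_cauchy_ring using I0 self[of a] self[of b] by force
  ultimately have "(\<lambda>n. a * b) \<in> mult Q (cl b) (cl a)" by simp
  then obtain i j k where ijk: "i \<in> I" "j \<in> I" "k \<in> I"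
    and eq: "\<And>n. a * b = i n + (j n + b) * (k n + a)"
    unfolding Q_def mult_FactRing_cauchy_ring cl_def by (auto simp: fun_eq_iff)
  have poly: "i n \<in> star_polys G" "j n \<in> star_polys G" "k n \<in> star_polys G" for n
    using ijk by (simp_all add: I_def null_sequences_def)
  have lim: "(\<lambda>n. N (i n)) \<longlonglongrightarrow> 0" "(\<lambda>n. N (j n)) \<longlonglongrightarrow> 0" "(\<lambda>n. N (k n)) \<longlonglongrightarrow> 0"
    using ijk seminorm_tendsto_zero[OF N bdd] by (simp_all add: I_def)
  have bound: "N (a * b - b * a) \<le> N (i n) + (N (j n) * (N (k n) + N a) + N b * N (k n))" for n
  proof -
    have "a * b - b * a = i n + (j n * (k n + a) + b * k n)"
      using eq[of n] by (simp add: algebra_simps)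
    also have "N \<dots> \<le> N (i n) + (N (j n * (k n + a)) + N (b * k n))"
      using cstar_seminormD(2)[OF N(1), of "i n" "j n * (k n + a) + b * k n"]
        cstar_seminormD(2)[OF N(1), of "j n * (k n + a)" "b * k n"] poly ab by simp
    also have "N (j n * (k n + a)) \<le> N (j n) * N (k n + a)"
      using cstar_seminormD(4)[OF N(1)] poly ab by simp
    also have "\<dots> \<le> N (j n) * (N (k n) + N a)"
      using cstar_seminormD(1,2)[OF N(1)] poly ab by (simp add: mult_left_mono)
    also have "N (b * k n) \<le> N b * N (k n)"
      using cstar_seminormD(4)[OF N(1)] poly ab by simp
    finally show ?thesis by simp
  qed
  have "(\<lambda>n. N (i n) + (N (j n) * (N (k n) + N a) + N b * N (k n))) \<longlonglongrightarrow> 0 + (0 * (0 + N a) + N b * 0)"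
    by (intro tendsto_intros lim)
  then have "N (a * b - b * a) \<le> 0"
    using bound by (intro LIMSEQ_le_const) auto
  with pos show False by simp
qed


section \<open>Twin vertices\<close>

definition proj1 :: "qubit \<Rightarrow> qubit"
  where "proj1 x = (fst x, 0)"

text \<open>
  The projection onto the diagonal; it does not commute with the projection onto the first axis.
\<close>

definition proj2 :: "qubit \<Rightarrow> qubit"
  where "proj2 x = ((fst x + snd x) / 2, (fst x + snd x) / 2)"

definition twin_magic_unitary :: "nat \<Rightarrow> nat \<Rightarrow> nat \<Rightarrow> nat \<Rightarrow> nat \<times> nat \<Rightarrow> qubit \<Rightarrow> qubit"
  where "twin_magic_unitary a b c d = (\<lambda>(i, j).
    if {i, j} \<subseteq> {a, b} then (if i = j then proj1 else (\<lambda>x. x - proj1 x))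
    else if {i, j} \<subseteq> {c, d} then (if i = j then proj2 else (\<lambda>x. x - proj2 x))
    else if i = j then (\<lambda>x. x) else (\<lambda>x. 0))"

lemma projection_identities:
  "bounded_linear proj1" "proj1 (cscale k x) = cscale k (proj1 x)"
  "inner (proj1 x) y = inner x (proj1 y)" "proj1 (proj1 x) = proj1 x"
  "bounded_linear proj2" "proj2 (cscale k x) = cscale k (proj2 x)"
  "inner (proj2 x) y = inner x (proj2 y)" "proj2 (proj2 x) = proj2 x"
proof -
  show "bounded_linear proj1" "bounded_linear proj2"
    unfolding proj1_def[abs_def] proj2_def[abs_def]
    by (intro bounded_linear_intros bounded_linear_Pair bounded_linear_add
        bounded_linear_compose[OF bounded_linear_divide] bounded_linear_fst bounded_linear_snd
        bounded_linear_zero)+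
qed (simp_all add: proj1_def proj2_def cscale_def inner_prod_def inner_complex_def field_simps)

lemma cscale_diff: "cscale c (x - y) = cscale c x - cscale c y"
  by (simp add: cscale_def algebra_simps)

lemma proj_diff: "proj1 (x - y) = proj1 x - proj1 y" "proj2 (x - y) = proj2 x - proj2 y"
  by (simp_all add: proj1_def proj2_def field_simps)

lemma self_adjoint_family_twin_magic_unitary: "self_adjoint_family (twin_magic_unitary a b c d)"
proof (rule self_adjoint_family.intro)
  fix g :: "nat \<times> nat" and x y :: qubit and k :: complex
  show "bounded_linear (twin_magic_unitary a b c d g)"
  proof -
    have "twin_magic_unitary a b c d g \<in>
        {proj1, \<lambda>x. x - proj1 x, proj2, \<lambda>x. x - proj2 x, \<lambda>x. x, \<lambda>x. 0}"
      by (cases g) (simp add: twin_magic_unitary_def)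
    then show ?thesis
      using bounded_linear_sub[OF bounded_linear_ident projection_identities(1)]
        bounded_linear_sub[OF bounded_linear_ident projection_identities(5)]
      by (auto simp: projection_identities bounded_linear_ident bounded_linear_zero)
  qed
  show "twin_magic_unitary a b c d g (cscale k x) = cscale k (twin_magic_unitary a b c d g x)"
    by (cases g) (simp add: twin_magic_unitary_def projection_identities cscale_diff)
  show "inner (twin_magic_unitary a b c d g x) y = inner x (twin_magic_unitary a b c d g y)"
    by (cases g) (simp add: twin_magic_unitary_def projection_identities inner_diff_left inner_diff_right)
qed

text \<open>
  The entry \<open>U (i, j)\<close> is nonzero only if \<open>i\<close> and \<open>j\<close> have the same neighbours. Hence both products
  with the adjacency matrix have the scalar entries of the adjacency matrix itself.
\<close>

lemma quantum_symmetry_of_disjoint_twins: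
  assumes abcd: "{a, b, c, d} \<subseteq> {1..n}" "distinct [a, b, c, d]"
    and ab: "\<And>k. {a, k} \<in> E \<longleftrightarrow> {b, k} \<in> E" and cd: "\<And>k. {c, k} \<in> E \<longleftrightarrow> {d, k} \<in> E"
  shows "has_quantum_symmetry n E"
proof -
  define U where "U = twin_magic_unitary a b c d"
  interpret self_adjoint_family U
    unfolding U_def by (rule self_adjoint_family_twin_magic_unitary)
  define R where "R = magic_unitary_relations n \<union> commutation_relations n (adjacency E)"
  have adj: "adjacency E i j = adjacency E j i" for i j
    by (simp add: adjacency_def insert_commute)
  have support: "adjacency E i k = adjacency E j k" if "U (i, j) x \<noteq> 0" for i j k x
    using that ab cd by (auto simp: U_def twin_magic_unitary_def adjacency_def split: if_splits)
  have symm: "U (i, j) = U (j, i)" for i j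
    by (auto simp: U_def twin_magic_unitary_def fun_eq_iff)
  have row: "(\<Sum>k=1..n. U (i, k) x) = x" if i: "i \<in> {1..n}" for i x
  proof -
    have "(\<Sum>k=1..n. U (i, k) x) = (\<Sum>k\<in>K. U (i, k) x)"
      if "K \<subseteq> {1..n}" "\<And>k. k \<notin> K \<Longrightarrow> U (i, k) x = 0" for K
      using that by (intro sum.mono_neutral_right) auto
    note restrict = this
    consider "i \<in> {a, b}" | "i \<in> {c, d}" | "i \<notin> {a, b, c, d}" by blast
    then show ?thesis
    proof cases
      case 1
      then have "(\<Sum>k=1..n. U (i, k) x) = (\<Sum>k\<in>{a, b}. U (i, k) x)"
        using abcd by (intro restrict) (auto simp: U_def twin_magic_unitary_def)
      then show ?thesis using 1 abcd by (auto simp: U_def twin_magic_unitary_def)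
    next
      case 2
      then have "(\<Sum>k=1..n. U (i, k) x) = (\<Sum>k\<in>{c, d}. U (i, k) x)"
        using abcd by (intro restrict) (auto simp: U_def twin_magic_unitary_def)
      then show ?thesis using 2 abcd by (auto simp: U_def twin_magic_unitary_def)
    next
      case 3
      then have "(\<Sum>k=1..n. U (i, k) x) = (\<Sum>k\<in>{i}. U (i, k) x)"
        using i by (intro restrict) (auto simp: U_def twin_magic_unitary_def)
      then show ?thesis using 3 by (auto simp: U_def twin_magic_unitary_def)
    qed
  qed
  have rep_relation: "rep U r x = 0" if "r \<in> R" for r x
  proof -
    note rep_simps = rep_diff rep_mult rep_sum rep_gen rep_one rep_scale_poly
    have idem: "U g (U g x) = U g x" for g
      by (cases g) (auto simp: U_def twin_magic_unitary_def projection_identities proj_diff)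
    have self: "rep U (adj_poly (gen g)) x = U g x" for g
      unfolding adj_gen by (simp add: rep_single word_op_def)
    \<comment> \<open>weights that are constant on the support of a row can be pulled out of the row sum\<close>
    have weighted: "(\<Sum>k=1..n. cscale (w k) (U (i, k) x)) = cscale (w i) x"
      if "i \<in> {1..n}" "\<And>k. U (i, k) x \<noteq> 0 \<Longrightarrow> w k = w i" for i w
    proof -
      have "cscale (w k) (U (i, k) x) = cscale (w i) (U (i, k) x)" for k
        using that(2)[of k] by (cases "U (i, k) x = 0") auto
      then show ?thesis using row[OF that(1), of x] by (simp flip: cscale_sum)
    qed
    have comm: "(\<Sum>k=1..n. cscale (adjacency E k j) (U (i, k) x))
        = (\<Sum>k=1..n. cscale (adjacency E i k) (U (k, j) x))"
      if "i \<in> {1..n}" "j \<in> {1..n}" for i j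
    proof -
      have "(\<Sum>k=1..n. cscale (adjacency E k j) (U (i, k) x)) = cscale (adjacency E i j) x"
        using that support by (intro weighted) metis+
      moreover have "(\<Sum>k=1..n. cscale (adjacency E i k) (U (j, k) x)) = cscale (adjacency E i j) x"
        using that support adj by (intro weighted) metis+
      ultimately show ?thesis by (simp add: symm[of _ j])
    qed
    have col: "(\<Sum>k=1..n. U (k, j) x) = x" if "j \<in> {1..n}" for j
      using row[OF that, of x] by (simp add: symm[of _ j])
    from that consider
        i j where "r = adj_poly (gen (i, j)) - gen (i, j)"
      | i j where "r = gen (i, j) * gen (i, j) - gen (i, j)"
      | i where "i \<in> {1..n}" "r = (\<Sum>k=1..n. gen (i, k)) - 1"
      | j where "j \<in> {1..n}" "r = (\<Sum>k=1..n. gen (k, j)) - 1"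
      | i j where "i \<in> {1..n}" "j \<in> {1..n}"
          "r = (\<Sum>k=1..n. scale_poly (adjacency E k j) (gen (i, k)))
            - (\<Sum>k=1..n. scale_poly (adjacency E i k) (gen (k, j)))"
      unfolding R_def magic_unitary_relations_def commutation_relations_def by blast
    then show ?thesis
    proof cases
      case 1
      then show ?thesis by (simp only: rep_simps self diff_self)
    next
      case 2
      then show ?thesis by (simp only: rep_simps idem diff_self)
    next
      case 3
      then show ?thesis by (simp only: rep_simps row diff_self)
    next
      case 4
      then show ?thesis by (simp only: rep_simps col diff_self)
    next
      case 5
      then show ?thesis by (simp only: rep_simps comm diff_self)
    qed
  qed
  have onorm_relation: "\<forall>r\<in>R. onorm (rep U r) = 0"
    by (simp add: rep_relation onorm_eq_0 bounded_linear_rep)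
  \<comment> \<open>the two products map \<open>(1, 0)\<close> to \<open>(1/2, 0)\<close> and \<open>(1/2, 1/2)\<close>\<close>
  have "rep U (gen (a, a) * gen (c, c) - gen (c, c) * gen (a, a)) (1, 0) \<noteq> 0"
    using abcd unfolding rep_diff rep_mult rep_gen
    by (simp add: U_def twin_magic_unitary_def proj1_def proj2_def zero_prod_def)
  then have "onorm (rep U (gen (a, a) * gen (c, c) - gen (c, c) * gen (a, a))) > 0"
    by (subst onorm_pos_lt[OF bounded_linear_rep]) blast
  moreover have "cstar_seminorm ({1..n} \<times> {1..n}) (\<lambda>p. onorm (rep U p))"
    by (rule cstar_seminorm_onorm_rep)
  moreover have "\<forall>p\<in>star_polys ({1..n} \<times> {1..n}). bdd_above ((\<lambda>N. N p) `
      {N. cstar_seminorm ({1..n} \<times> {1..n}) N \<and> (\<forall>r\<in>R. N r = 0)})"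
    unfolding R_def by (intro ballI C_QAut_bdd_above)
  moreover have "gen (a, a) \<in> star_polys ({1..n} \<times> {1..n})" "gen (c, c) \<in> star_polys ({1..n} \<times> {1..n})"
    using abcd by simp_all
  ultimately show ?thesis
    using not_commutative_if_seminorm_commutator[of _ "\<lambda>p. onorm (rep U p)" R] onorm_relation
    unfolding has_quantum_symmetry_def C_QAut_def R_def[symmetric] by blast
qed


section \<open>Trees on a finite vertex set\<close>

definition edges_on :: "nat set \<Rightarrow> nat set set"
  where "edges_on V = {e. e \<subseteq> V \<and> card e = 2}"

definition trees_on :: "nat set \<Rightarrow> nat set set set"
  where "trees_on V = {E. E \<subseteq> edges_on V \<and>
    (\<forall>i\<in>V. \<forall>j\<in>V. (i, j) \<in> {(v, w). {v, w} \<in> E}\<^sup>*) \<and> \<not> has_cycle E}"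

text \<open>
  A single equation that says both that \<open>s\<close> is a leaf and where it hangs. For fixed \<open>s\<close> and \<open>w\<close>, it
  only depends on the edges at \<open>s\<close>, which is what makes leaves independent of each other.
\<close>

definition pendant :: "nat set set \<Rightarrow> nat \<Rightarrow> nat \<Rightarrow> bool"
  where "pendant E s w \<longleftrightarrow> {e \<in> E. s \<in> e} = {{s, w}}"

lemma labelled_trees_eq: "labelled_trees n = trees_on {1..n}"
  by (simp add: labelled_trees_def trees_on_def simple_graph_def connected_graph_def edges_on_def)

lemma finite_trees: "finite V \<Longrightarrow> finite (trees_on V)"
  by (rule finite_subset[of _ "Pow (Pow V)"]) (auto simp: trees_on_def edges_on_def)

lemma pendant_edge_iff:
  assumes "pendant E s w" shows "e \<in> E \<and> s \<in> e \<longleftrightarrow> e = {s, w}"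
proof -
  have "e \<in> {e \<in> E. s \<in> e} \<longleftrightarrow> e \<in> {{s, w}}"
    using assms unfolding pendant_def by (simp only:)
  then show ?thesis by simp
qed

lemma pendantD: "pendant E s w \<Longrightarrow> {s, w} \<in> E"
  using pendant_edge_iff[of E s w "{s, w}"] by simp

lemma pendant_iff: "pendant E s w \<Longrightarrow> {s, x} \<in> E \<longleftrightarrow> x = w"
  using pendant_edge_iff[of E s w "{s, x}"] by (auto simp: doubleton_eq_iff)

lemma pendant_unique: "pendant E s w \<Longrightarrow> pendant E s w' \<Longrightarrow> w = w'"
  using pendant_iff[of E s w w'] pendantD[of E s w'] by simp

lemma subset_edges_on: "T \<in> trees_on V \<Longrightarrow> T \<subseteq> edges_on V"
  by (simp add: trees_on_def)

lemma edge_in_trees: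
  assumes "T \<in> trees_on V" "{v, w} \<in> T"
  shows "v \<in> V" "w \<in> V" "v \<noteq> w"
  using assms by (auto simp: trees_on_def edges_on_def)

text \<open>
  Folding the new leaf \<open>v\<close> onto its neighbour \<open>w\<close> maps every path of the larger graph to a path of the
  smaller one.
\<close>

lemma connected_add_leaf:
  assumes v: "v \<notin> V" and w: "w \<in> V" and E: "E \<subseteq> edges_on V"
  shows "(\<forall>i\<in>insert v V. \<forall>j\<in>insert v V. (i, j) \<in> {(x, y). {x, y} \<in> insert {v, w} E}\<^sup>*)
    \<longleftrightarrow> (\<forall>i\<in>V. \<forall>j\<in>V. (i, j) \<in> {(x, y). {x, y} \<in> E}\<^sup>*)"
    (is "?L \<longleftrightarrow> ?R")
proof
  let ?A = "{(x, y). {x, y} \<in> insert {v, w} E}" and ?B = "{(x, y). {x, y} \<in> E}"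
  define r where "r x = (if x = v then w else x)" for x
  have edge: "(r x, r y) \<in> ?B\<^sup>*" if "(x, y) \<in> ?A" for x y
  proof (cases "{x, y} = {v, w}")
    case True
    then show ?thesis by (auto simp: r_def doubleton_eq_iff)
  next
    case False
    then have "{x, y} \<in> E" "v \<notin> {x, y}" using that E v by (auto simp: edges_on_def)
    then show ?thesis by (auto simp: r_def)
  qed
  have path: "(r i, r j) \<in> ?B\<^sup>*" if "(i, j) \<in> ?A\<^sup>*" for i j
    using that
  proof induction
    case (step y z)
    show ?case by (rule rtrancl_trans[OF step.IH edge[OF step.hyps(2)]])
  qed simp
  show ?R if ?L
  proof (intro ballI)
    fix i j assume ij: "i \<in> V" "j \<in> V"
    then have "(i, j) \<in> ?A\<^sup>*" using \<open>?L\<close> by blast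
    moreover have "r i = i" "r j = j" using ij v by (auto simp: r_def)
    ultimately show "(i, j) \<in> ?B\<^sup>*" using path[of i j] by simp
  qed
  show ?L if ?R
  proof -
    have "?B\<^sup>* \<subseteq> ?A\<^sup>*" by (rule rtrancl_mono) auto
    then have R: "(i, j) \<in> ?A\<^sup>*" if "i \<in> V" "j \<in> V" for i j using \<open>?R\<close> that by blast
    have vw: "(v, w) \<in> ?A" "(w, v) \<in> ?A" by (auto simp: insert_commute)
    show ?L
    proof (intro ballI)
      fix i j assume "i \<in> insert v V" "j \<in> insert v V"
      then have "(i, w) \<in> ?A\<^sup>*" "(w, j) \<in> ?A\<^sup>*"
        using R w vw by blast+
      then show "(i, j) \<in> ?A\<^sup>*" by simp
    qed
  qed
qed

lemma has_cycle_mono: "has_cycle E \<Longrightarrow> E \<subseteq> F \<Longrightarrow> has_cycle F"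
  unfolding has_cycle_def by blast

text \<open>
  A cycle through \<open>v\<close> would have two different neighbours of \<open>v\<close> on it, but \<open>w\<close> is the only one.
\<close>

lemma has_cycle_add_leaf:
  assumes v: "v \<notin> \<Union>E"
  shows "has_cycle (insert {v, w} E) \<longleftrightarrow> has_cycle E"
proof
  assume "has_cycle (insert {v, w} E)"
  then obtain vs where vs: "distinct vs" "length vs \<ge> 3"
    and edge: "\<And>i. i < length vs \<Longrightarrow> {vs ! i, vs ! (Suc i mod length vs)} \<in> insert {v, w} E"
    unfolding has_cycle_def by blast
  let ?n = "length vs"
  have "v \<notin> set vs"
  proof
    assume "v \<in> set vs"
    then obtain k where k: "k < ?n" "vs ! k = v" by (auto simp: in_set_conv_nth)
    define p where "p = (if k = 0 then ?n - 1 else k - 1)"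
    define q where "q = Suc k mod ?n"
    have p: "p < ?n" "Suc p mod ?n = k" using k vs by (auto simp: p_def)
    have q: "q < ?n" using vs unfolding q_def by (intro mod_less_divisor) linarith
    have "p \<noteq> q"
    proof (cases "Suc k = ?n")
      case True then show ?thesis using vs k by (auto simp: p_def q_def)
    next
      case False then show ?thesis using vs k by (auto simp: p_def q_def)
    qed
    then have ne: "vs ! p \<noteq> vs ! q" using p q vs by (simp add: nth_eq_iff_index_eq)
    have "{vs ! p, v} = {v, w}" using edge[OF p(1)] p k v by auto
    moreover have "{v, vs ! q} = {v, w}" using edge[OF k(1)] k v by (auto simp: q_def)
    ultimately show False using ne by (auto simp: doubleton_eq_iff)
  qed
  have "{vs ! i, vs ! (Suc i mod ?n)} \<in> E" if "i < ?n" for i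
  proof -
    have "vs ! i \<noteq> v" "vs ! (Suc i mod ?n) \<noteq> v"
      using \<open>v \<notin> set vs\<close> that nth_mem[of i vs] nth_mem[OF mod_less_divisor, of vs "Suc i"]
      by (cases vs; auto)+
    then show ?thesis using edge[OF that] by (auto simp: doubleton_eq_iff)
  qed
  then show "has_cycle E" using vs unfolding has_cycle_def by blast
qed (auto elim: has_cycle_mono)

lemma trees_add_leaf:
  assumes v: "v \<notin> V" and w: "w \<in> V" and E: "E \<subseteq> edges_on V"
  shows "insert {v, w} E \<in> trees_on (insert v V) \<longleftrightarrow> E \<in> trees_on V"
proof -
  have "v \<notin> \<Union>E" using v E by (auto simp: edges_on_def)
  moreover have "insert {v, w} E \<subseteq> edges_on (insert v V)"
    using v w E by (auto simp: edges_on_def card_insert_if)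
  ultimately show ?thesis
    using E unfolding trees_on_def mem_Collect_eq
    by (simp only: connected_add_leaf[OF v w E] has_cycle_add_leaf simp_thms)
qed

lemma trees_add_leaves:
  assumes "finite S" "S \<inter> W = {}" "f ` S \<subseteq> W" "E \<subseteq> edges_on W"
  shows "E \<union> (\<lambda>s. {s, f s}) ` S \<in> trees_on (W \<union> S) \<longleftrightarrow> E \<in> trees_on W"
  using assms
proof (induction S)
  case (insert s S)
  have fW: "f t \<in> W" "t \<notin> W" if "t \<in> insert s S" for t
    using that insert.prems(1,2) by auto
  have "{t, f t} \<in> edges_on (W \<union> S)" if "t \<in> S" for t
  proof -
    have "f t \<in> W" "t \<noteq> f t" using that fW[of t] by auto
    then show ?thesis using that by (simp add: edges_on_def)
  qed
  moreover have "E \<subseteq> edges_on (W \<union> S)"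
    using insert.prems(3) unfolding edges_on_def by blast
  ultimately have "E \<union> (\<lambda>s. {s, f s}) ` S \<subseteq> edges_on (W \<union> S)"
    by (simp add: image_subset_iff)
  then have "insert {s, f s} (E \<union> (\<lambda>s. {s, f s}) ` S) \<in> trees_on (insert s (W \<union> S))
      \<longleftrightarrow> E \<union> (\<lambda>s. {s, f s}) ` S \<in> trees_on (W \<union> S)"
    using fW[of s] insert.hyps by (intro trees_add_leaf) auto
  also have "\<dots> \<longleftrightarrow> E \<in> trees_on W"
    using insert.prems by (intro insert.IH) auto
  finally show ?case by simp
qed simp

text \<open>
  Attaching each \<open>s\<close> in \<open>S\<close> to \<open>f s\<close> and deleting the vertices of \<open>S\<close> are inverse to each other.
\<close>

lemma card_trees_pendant:
  assumes S: "finite S" "S \<inter> W = {}" "f ` S \<subseteq> W"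
  shows "card {T \<in> trees_on (W \<union> S). \<forall>s\<in>S. pendant T s (f s)} = card (trees_on W)"
proof -
  let ?F = "(\<lambda>s. {s, f s}) ` S"
  let ?P = "{T \<in> trees_on (W \<union> S). \<forall>s\<in>S. pendant T s (f s)}"
  have avoid: "s \<notin> e" if "E \<in> trees_on W" "e \<in> E" "s \<in> S" for E e s
    using that S by (auto simp: trees_on_def edges_on_def)
  have disj: "E \<inter> ?F = {}" if "E \<in> trees_on W" for E
    using avoid[OF that] by auto
  have "bij_betw (\<lambda>E. E \<union> ?F) (trees_on W) ?P"
    unfolding bij_betw_def
  proof
    show "inj_on (\<lambda>E. E \<union> ?F) (trees_on W)"
    proof (rule inj_onI)
      fix E E' assume E: "E \<in> trees_on W" "E' \<in> trees_on W" "E \<union> ?F = E' \<union> ?F"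
      have "E = (E \<union> ?F) - ?F" using disj[OF E(1)] by (simp add: Un_Diff Diff_triv)
      also have "\<dots> = (E' \<union> ?F) - ?F" by (simp only: E(3))
      also have "\<dots> = E'" using disj[OF E(2)] by (simp add: Un_Diff Diff_triv)
      finally show "E = E'" .
    qed
    show "(\<lambda>E. E \<union> ?F) ` trees_on W = ?P"
    proof
      show "(\<lambda>E. E \<union> ?F) ` trees_on W \<subseteq> ?P"
      proof (rule image_subsetI)
        fix E assume E: "E \<in> trees_on W"
        have "E \<subseteq> edges_on W" by (rule subset_edges_on[OF E])
        then have "E \<union> ?F \<in> trees_on (W \<union> S)"
          using trees_add_leaves[OF S, of E] E by blast
        moreover have "pendant (E \<union> ?F) s (f s)" if "s \<in> S" for s
        proof -
          have "f s' \<noteq> s" if "s' \<in> S" for s' using that \<open>s \<in> S\<close> S by blast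
          then have "{e \<in> E \<union> ?F. s \<in> e} = {{s, f s}}"
            using that avoid[OF E, of _ s] by auto
          then show ?thesis by (simp only: pendant_def)
        qed
        ultimately show "E \<union> ?F \<in> ?P" by simp
      qed
      show "?P \<subseteq> (\<lambda>E. E \<union> ?F) ` trees_on W"
      proof
        fix T assume T: "T \<in> ?P"
        have F: "?F \<subseteq> T"
        proof (rule image_subsetI)
          fix s assume "s \<in> S"
          then have "pendant T s (f s)" using T by simp
          then show "{s, f s} \<in> T" by (rule pendantD)
        qed
        have "e \<in> edges_on W" if "e \<in> T - ?F" for e
        proof -
          have "e \<in> edges_on (W \<union> S)" using T that subset_edges_on by blast
          moreover have "s \<notin> e" if "s \<in> S" for s
          proof
            assume "s \<in> e"
            then have "e = {s, f s}"
              using T that \<open>e \<in> T - ?F\<close> pendant_edge_iff[of T s "f s" e] by simp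
            then show False using that \<open>e \<in> T - ?F\<close> by simp
          qed
          ultimately show ?thesis by (auto simp: edges_on_def)
        qed
        then have "T - ?F \<subseteq> edges_on W" by (rule subsetI)
        moreover have T_eq: "T = (T - ?F) \<union> ?F" using F by auto
        ultimately have "T - ?F \<in> trees_on W"
          using trees_add_leaves[OF S, of "T - ?F"] T by simp
        moreover note T_eq
        ultimately show "T \<in> (\<lambda>E. E \<union> ?F) ` trees_on W" by blast
      qed
    qed
  qed
  then show ?thesis by (simp add: bij_betw_same_card)
qed

text \<open>
  A tree determines the attaching function on \<open>S\<close>, so different functions contribute
  disjoint sets of trees.
\<close>

lemma card_trees_pendant_family:
  assumes "finite V" "S \<subseteq> V" and F: "F \<subseteq> S \<rightarrow>\<^sub>E V - S"
  shows "card {T \<in> trees_on V. \<exists>f\<in>F. \<forall>s\<in>S. pendant T s (f s)} = card F * card (trees_on (V - S))"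
proof -
  have S: "finite S" "(V - S) \<union> S = V" using assms by (auto intro: finite_subset)
  have fin: "finite F"
    using finite_subset[OF F] assms S by (simp add: finite_PiE)
  let ?P = "\<lambda>f. {T \<in> trees_on V. \<forall>s\<in>S. pendant T s (f s)}"
  have "{T \<in> trees_on V. \<exists>f\<in>F. \<forall>s\<in>S. pendant T s (f s)} = (\<Union>f\<in>F. ?P f)" by blast
  also have "card \<dots> = (\<Sum>f\<in>F. card (?P f))"
  proof (rule card_UN_disjoint[OF fin])
    show "\<forall>f\<in>F. finite (?P f)" using finite_trees assms by simp
    show "\<forall>f\<in>F. \<forall>g\<in>F. f \<noteq> g \<longrightarrow> ?P f \<inter> ?P g = {}"
    proof (intro ballI impI equals0I)
      fix f g T assume fg: "f \<in> F" "g \<in> F" "f \<noteq> g" and T: "T \<in> ?P f \<inter> ?P g"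
      have "f s = g s" if "s \<in> S" for s using T that pendant_unique by blast
      then have "f = g" using fg F by (intro PiE_ext[of f S _ g]) auto
      then show False using fg by simp
    qed
  qed
  also have "\<dots> = (\<Sum>f\<in>F. card (trees_on (V - S)))"
  proof (rule sum.cong)
    fix f assume "f \<in> F"
    then have "f ` S \<subseteq> V - S" using F by auto
    then show "card (?P f) = card (trees_on (V - S))"
      using card_trees_pendant[of S "V - S" f] S by auto
  qed simp
  finally show ?thesis by simp
qed


section \<open>Cayley's formula\<close>

text \<open>
  The first vertex \<open>x\<close> of a longest path is a leaf: a neighbour of \<open>x\<close> outside the path would prolong
  it, and a neighbour on the path other than the next vertex would close a cycle.
\<close>

lemma tree_has_leaf:
  assumes T: "T \<in> trees_on V" and V: "finite V" "card V \<ge> 2"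
  shows "\<exists>s\<in>V. \<exists>w. pendant T s w"
proof -
  define path where "path vs \<longleftrightarrow> distinct vs \<and> set vs \<subseteq> V \<and> vs \<noteq> [] \<and>
    (\<forall>i. Suc i < length vs \<longrightarrow> {vs ! i, vs ! Suc i} \<in> T)" for vs
  have bound: "length vs \<le> card V" if "path vs" for vs
    using that V by (metis path_def card_mono distinct_card)
  obtain u where u: "u \<in> V" using V by fastforce
  then have "path [u]" by (simp add: path_def)
  then have "\<exists>vs. path vs \<and> (\<forall>ws. path ws \<longrightarrow> length ws \<le> length vs)"
    using bound by (intro ex_has_greatest_nat[of path "[u]" length "Suc (card V)"]) (auto simp: le_imp_less_Suc)
  then obtain vs where vs: "path vs" and longest: "\<And>ws. path ws \<Longrightarrow> length ws \<le> length vs"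
    by blast
  define x where "x = hd vs"
  have x: "x = vs ! 0" "x \<in> V" using vs by (auto simp: x_def path_def hd_conv_nth)
  have neighbour: "vs \<noteq> [x] \<and> y = vs ! 1" if y: "{x, y} \<in> T" for y
  proof -
    have yV: "y \<in> V" "y \<noteq> x" using edge_in_trees[OF T y] by auto
    have "y \<in> set vs"
    proof (rule ccontr)
      assume "y \<notin> set vs"
      have "{(y # vs) ! i, (y # vs) ! Suc i} \<in> T" if "Suc i < length (y # vs)" for i
        using that vs y x by (cases i) (auto simp: path_def insert_commute)
      then have "path (y # vs)" using \<open>y \<notin> set vs\<close> vs yV unfolding path_def by simp
      then show False using longest by fastforce
    qed
    then obtain k where k: "k < length vs" "vs ! k = y" by (auto simp: in_set_conv_nth)
    have "k \<noteq> 0" using k x yV by metis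
    moreover have "\<not> k \<ge> 2"
    proof
      assume "k \<ge> 2"
      let ?c = "take (Suc k) vs"
      have len: "length ?c = Suc k" using k by simp
      have "{?c ! i, ?c ! (Suc i mod length ?c)} \<in> T" if "i < length ?c" for i
      proof (cases "i = k")
        case True
        then show ?thesis using len k y x by (simp add: insert_commute)
      next
        case False
        then show ?thesis using that len k vs by (auto simp: path_def)
      qed
      then have "has_cycle T"
        unfolding has_cycle_def using len vs \<open>k \<ge> 2\<close> by (intro exI[of _ ?c]) (auto simp: path_def)
      then show False using T by (simp add: trees_on_def)
    qed
    ultimately have "k = 1" by simp
    then show ?thesis using k by auto
  qed
  have "\<exists>y. {x, y} \<in> T"
  proof -
    have "V \<noteq> {x}" using V by auto
    then obtain z where "z \<in> V" "z \<noteq> x" using x by blast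
    then have "(x, z) \<in> {(v, w). {v, w} \<in> T}\<^sup>*" using T x by (auto simp: trees_on_def)
    then show ?thesis using \<open>z \<noteq> x\<close> by (auto elim: converse_rtranclE)
  qed
  then obtain y where y: "{x, y} \<in> T" by blast
  have "e = {x, y}" if e: "e \<in> T" "x \<in> e" for e
  proof -
    have "card e = 2" using e subset_edges_on[OF T] by (auto simp: edges_on_def)
    then obtain z where z: "e = {x, z}" using e(2) by (auto simp: card_2_iff)
    then show ?thesis using neighbour[of z] neighbour[OF y] e(1) by simp
  qed
  then have "pendant T x y" using y unfolding pendant_def by blast
  then show ?thesis using x by blast
qed

text \<open>
  Two adjacent leaves form a connected component. The bound excludes the tree with a
  single edge.
\<close>

lemma leaves_not_adjacent:
  assumes T: "T \<in> trees_on V" and V: "card V \<ge> 3" and s: "pendant T s w"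
  shows "\<not> pendant T w w'"
proof
  assume w: "pendant T w w'"
  have "w' = s" using pendantD[OF s] pendant_iff[OF w] by (simp add: insert_commute)
  have closed: "y \<in> {s, w}" if "(s, y) \<in> {(v, w). {v, w} \<in> T}\<^sup>*" for y
    using that
  proof induction
    case (step y z)
    then show ?case using pendant_iff[OF s, of z] pendant_iff[OF w, of z] \<open>w' = s\<close> by auto
  qed simp
  have "V \<subseteq> {s, w}"
    using closed T edge_in_trees(1)[OF T pendantD[OF s]] unfolding trees_on_def by blast
  then have "card V \<le> card {s, w}" by (intro card_mono) auto
  also have "\<dots> \<le> 2" by (simp add: card_insert_if)
  finally show False using V by simp
qed

lemma card_trees_leaves:
  assumes V: "finite V" "card V \<ge> 3" and S: "S \<subseteq> V"
  shows "card {T \<in> trees_on V. \<forall>s\<in>S. \<exists>w. pendant T s w} = card (V - S) ^ card S * card (trees_on (V - S))"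
proof -
  let ?F = "S \<rightarrow>\<^sub>E V - S"
  have "(\<forall>s\<in>S. \<exists>w. pendant T s w) \<longleftrightarrow> (\<exists>f\<in>?F. \<forall>s\<in>S. pendant T s (f s))" if T: "T \<in> trees_on V" for T
  proof
    assume "\<forall>s\<in>S. \<exists>w. pendant T s w"
    then obtain g where g: "\<And>s. s \<in> S \<Longrightarrow> pendant T s (g s)" by metis
    have "g s \<in> V - S" if s: "s \<in> S" for s
    proof
      show "g s \<in> V" by (rule edge_in_trees(2)[OF T pendantD[OF g[OF s]]])
      show "g s \<notin> S" using g leaves_not_adjacent[OF T V(2) g[OF s]] by blast
    qed
    then have "restrict g S \<in> ?F" by simp
    moreover have "\<forall>s\<in>S. pendant T s (restrict g S s)" using g by simp
    ultimately show "\<exists>f\<in>?F. \<forall>s\<in>S. pendant T s (f s)" by (rule bexI[where P = "\<lambda>f. \<forall>s\<in>S. pendant T s (f s)", rotated])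
  next
    show "\<forall>s\<in>S. \<exists>w. pendant T s w" if "\<exists>f\<in>?F. \<forall>s\<in>S. pendant T s (f s)"
      using that by auto
  qed
  then have "card {T \<in> trees_on V. \<forall>s\<in>S. \<exists>w. pendant T s w}
      = card {T \<in> trees_on V. \<exists>f\<in>?F. \<forall>s\<in>S. pendant T s (f s)}"
    by (intro arg_cong[of _ _ card]) blast
  also have "\<dots> = card ?F * card (trees_on (V - S))"
    by (rule card_trees_pendant_family) (use assms in auto)
  finally show ?thesis
    using assms finite_subset by (subst (asm) card_PiE) (auto simp: prod_constant)
qed

lemma sum_Pow_alternating:
  assumes "finite A" "A \<noteq> {}"
  shows "(\<Sum>S\<in>Pow A. (- 1) ^ card S) = (0 :: int)"
proof -
  have "(\<Prod>x\<in>A. 1 - 1 :: int) = (\<Sum>S\<in>Pow A. (- 1) ^ card S * (\<Prod>x\<in>S. 1) * (\<Prod>x\<in>A - S. 1))"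
    by (rule prod_diff_conv_sum[OF assms(1)])
  then show ?thesis using assms by (simp add: power_0_left)
qed

text \<open>
  After exchanging the sums, each \<open>x\<close> contributes the alternating sum over all subsets of a nonempty
  set. The lemma is used twice: for trees and their leaves, and for functions and the points that they
  miss.
\<close>

lemma sum_inclusion_exclusion_zero:
  fixes L :: "'a \<Rightarrow> 'b set"
  assumes "finite X" "finite V" and L: "\<And>x. x \<in> X \<Longrightarrow> L x \<subseteq> V \<and> L x \<noteq> {}"
  shows "(\<Sum>S\<in>Pow V. (- 1) ^ card S * int (card {x \<in> X. S \<subseteq> L x})) = 0"
proof -
  have "(\<Sum>S\<in>Pow V. (- 1) ^ card S * int (card {x \<in> X. S \<subseteq> L x}))
      = (\<Sum>S\<in>Pow V. \<Sum>x\<in>X. if S \<subseteq> L x then (- 1) ^ card S else 0)"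
    using assms(1) by (simp add: sum.If_cases Int_def conj_commute mult.commute)
  also have "\<dots> = (\<Sum>x\<in>X. \<Sum>S\<in>Pow V. if S \<subseteq> L x then (- 1) ^ card S else 0)"
    by (rule sum.swap)
  also have "\<dots> = (\<Sum>x\<in>X. \<Sum>S\<in>Pow (L x). (- 1) ^ card S)"
  proof (rule sum.cong)
    fix x assume "x \<in> X"
    then have "{S \<in> Pow V. S \<subseteq> L x} = Pow (L x)" using L by blast
    then show "(\<Sum>S\<in>Pow V. if S \<subseteq> L x then (- 1) ^ card S else 0)
        = (\<Sum>S\<in>Pow (L x). (- 1) ^ card S :: int)"
      using assms(2) by (simp add: sum.If_cases Int_def)
  qed simp
  also have "\<dots> = 0"
    using L assms(2) by (intro sum.neutral ballI sum_Pow_alternating) (auto intro: finite_subset)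
  finally show ?thesis .
qed

text \<open>
  A combinatorial form of the vanishing of the \<open>n\<close>-th finite difference of a polynomial of smaller
  degree: \<open>card (V - S) ^ m\<close> counts the functions from \<open>m\<close> points to \<open>V\<close> that miss \<open>S\<close>, and each such
  function misses some point of \<open>V\<close>.
\<close>

lemma sum_Pow_alternating_power:
  assumes "finite V" "m < card V"
  shows "(\<Sum>S\<in>Pow V. (- 1) ^ card S * int (card (V - S) ^ m)) = 0"
proof -
  let ?X = "{..<m} \<rightarrow>\<^sub>E V"
  let ?L = "\<lambda>g. V - g ` {..<m}"
  have count: "card {g \<in> ?X. S \<subseteq> ?L g} = card (V - S) ^ m" if "S \<in> Pow V" for S
  proof -
    have "{g \<in> ?X. S \<subseteq> ?L g} = ({..<m} \<rightarrow>\<^sub>E V - S)"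
    proof (intro Set.set_eqI iffI)
      fix g assume "g \<in> {g \<in> ?X. S \<subseteq> ?L g}"
      then show "g \<in> ({..<m} \<rightarrow>\<^sub>E V - S)" by (auto simp: PiE_iff)
    next
      fix g assume g: "g \<in> ({..<m} \<rightarrow>\<^sub>E V - S)"
      then have "g i \<notin> S" if "i < m" for i using that by (auto simp: PiE_iff)
      then show "g \<in> {g \<in> ?X. S \<subseteq> ?L g}" using g \<open>S \<in> Pow V\<close> by (auto simp: PiE_iff)
    qed
    then show ?thesis by (simp add: card_PiE)
  qed
  have "?L g \<noteq> {}" for g
  proof
    assume "?L g = {}"
    then have "card V \<le> card (g ` {..<m})" by (intro card_mono) auto
    also have "\<dots> \<le> m" using card_image_le[of "{..<m}" g] by simp
    finally show False using assms by simp
  qed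
  then have "(\<Sum>S\<in>Pow V. (- 1) ^ card S * int (card {g \<in> ?X. S \<subseteq> ?L g})) = 0"
    using assms by (intro sum_inclusion_exclusion_zero) (auto intro: finite_PiE)
  then show ?thesis by (simp only: count cong: sum.cong)
qed

lemma trees_singleton: "trees_on {x} = {{}}"
proof -
  have "edges_on {x} = {}" by (auto simp: edges_on_def card_2_iff subset_singleton_iff)
  moreover have "\<not> has_cycle {}" by (force simp: has_cycle_def)
  ultimately show ?thesis by (auto simp: trees_on_def)
qed

lemma trees_doubleton:
  assumes "x \<noteq> y" shows "trees_on {x, y} = {{{x, y}}}"
proof -
  have "edges_on {x, y} = {{x, y}}"
    using assms by (auto simp: edges_on_def card_2_iff)
  then have "T = {} \<or> T = {{x, y}}" if "T \<in> trees_on {x, y}" for T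
    using subset_edges_on[OF that] by (simp add: subset_singleton_iff)
  moreover have "{} \<notin> trees_on {x, y}"
  proof
    assume "{} \<in> trees_on {x, y}"
    then have "(x, y) \<in> {(v, w). {v, w} \<in> {}}\<^sup>*" unfolding trees_on_def by blast
    then show False using assms by simp
  qed
  moreover have "{{x, y}} \<in> trees_on {x, y}"
    using trees_add_leaf[of x "{y}" y "{}"] assms by (simp add: trees_singleton)
  ultimately show ?thesis by blast
qed

text \<open>
  For \<open>n \<ge> 3\<close>, the trees in which all vertices of \<open>S\<close> are leaves number
  \<open>(n - k) ^ k * (n - k) ^ (n - k - 2) = (n - k) ^ (n - 2)\<close> for \<open>0 < k = card S < n\<close>, by induction; for
  \<open>k = n\<close> both sides vanish. As no tree has an empty set of leaves, the alternating sum over all \<open>S\<close> of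
  the number of these trees is zero; so is the alternating sum of \<open>(n - k) ^ (n - 2)\<close>. Hence the two
  also agree at \<open>S = {}\<close>.
\<close>

theorem cayley_formula:
  assumes "finite V" "V \<noteq> {}"
  shows "card (trees_on V) = card V ^ (card V - 2)"
  using assms
proof (induction "card V" arbitrary: V rule: less_induct)
  case less
  let ?n = "card V"
  have "?n > 0" using less.prems by (simp add: card_gt_0_iff)
  then consider "?n = 1" | "?n = 2" | "?n \<ge> 3" by linarith
  then show ?case
  proof cases
    case 1
    then show ?thesis by (auto simp: card_1_singleton_iff trees_singleton)
  next
    case 2
    then obtain x y where "V = {x, y}" "x \<noteq> y" by (auto simp: card_2_iff)
    then show ?thesis by (simp add: trees_doubleton)
  next
    case 3
    let ?L = "\<lambda>T. {s \<in> V. \<exists>w. pendant T s w}"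
    have count: "int (card {T \<in> trees_on V. S \<subseteq> ?L T}) = int (card (V - S) ^ (?n - 2)) +
        (if S = {} then int (card (trees_on V)) - int (?n ^ (?n - 2)) else 0)" if S: "S \<subseteq> V" for S
    proof (cases "S = {}")
      case True
      then show ?thesis by simp
    next
      case False
      have finS: "finite S" using S less.prems finite_subset by blast
      have card: "card (V - S) = ?n - card S" "card S > 0" "card S \<le> ?n"
        using S less.prems finS False by (auto simp: card_Diff_subset card_gt_0_iff card_mono)
      have "{T \<in> trees_on V. S \<subseteq> ?L T} = {T \<in> trees_on V. \<forall>s\<in>S. \<exists>w. pendant T s w}"
        using S by blast
      then have "card {T \<in> trees_on V. S \<subseteq> ?L T} = card (V - S) ^ card S * card (trees_on (V - S))"
        using card_trees_leaves[OF less.prems(1) 3 S] by simp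
      also have "\<dots> = card (V - S) ^ (?n - 2)"
      proof (cases "S = V")
        case True
        then show ?thesis using 3 by (simp add: power_0_left)
      next
        case nV: False
        then have ne: "V - S \<noteq> {}" using S by blast
        then have pos: "card (V - S) > 0" using less.prems by (simp add: card_gt_0_iff)
        have IH: "card (trees_on (V - S)) = card (V - S) ^ (card (V - S) - 2)"
          using less.hyps[of "V - S"] ne less.prems card by simp
        show ?thesis
        \<comment> \<open>the exponent \<open>card (V - S) - 2\<close> is truncated for a single vertex; the base is then 1\<close>
        proof (cases "card (V - S) = 1")
          case True
          then show ?thesis using IH by simp
        next
          case False
          then have "card S + (card (V - S) - 2) = ?n - 2" using card pos by linarith
          then show ?thesis using IH by (simp flip: power_add)
        qed
      qed
      finally show ?thesis using False by simp
    qed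
    have "?L T \<noteq> {}" if "T \<in> trees_on V" for T
      using tree_has_leaf[OF that less.prems(1)] 3 by auto
    then have "0 = (\<Sum>S\<in>Pow V. (- 1) ^ card S * int (card {T \<in> trees_on V. S \<subseteq> ?L T}))"
      using less.prems by (intro sum_inclusion_exclusion_zero[symmetric] finite_trees) auto
    also have "\<dots> = (\<Sum>S\<in>Pow V. (- 1) ^ card S * int (card (V - S) ^ (?n - 2)) +
        (if S = {} then int (card (trees_on V)) - int (?n ^ (?n - 2)) else 0))"
      using count by (intro sum.cong) (auto simp: algebra_simps)
    also have "\<dots> = int (card (trees_on V)) - int (?n ^ (?n - 2))"
      using sum_Pow_alternating_power[of V "?n - 2"] less.prems 3
      by (simp add: sum.distrib)
    finally show ?thesis by simp
  qed
qed


section \<open>Pairs of twin leaves\<close>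

definition twins :: "nat set set \<Rightarrow> nat \<times> nat \<Rightarrow> bool"
  where "twins T p \<longleftrightarrow> fst p \<noteq> snd p \<and> (\<exists>w. \<forall>s\<in>{fst p, snd p}. pendant T s w)"

definition off_diagonal :: "'a set \<Rightarrow> ('a \<times> 'a) set"
  where "off_diagonal A = {p \<in> A \<times> A. fst p \<noteq> snd p}"

definition twin_pairs :: "nat set \<Rightarrow> nat set set \<Rightarrow> (nat \<times> nat) set"
  where "twin_pairs V T = {p \<in> off_diagonal V. twins T p}"

lemma finite_off_diagonal: "finite A \<Longrightarrow> finite (off_diagonal A)"
  by (simp add: off_diagonal_def)

lemma card_off_diagonal:
  assumes "finite A" shows "card (off_diagonal A) = card A * (card A - 1)"
proof -
  have "off_diagonal A = A \<times> A - (\<lambda>x. (x, x)) ` A" by (auto simp: off_diagonal_def)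
  moreover have "card ((\<lambda>x. (x, x)) ` A) = card A" by (intro card_image inj_onI) simp
  moreover have "(\<lambda>x. (x, x)) ` A \<subseteq> A \<times> A" by auto
  ultimately show ?thesis
    using assms by (simp add: card_Diff_subset card_cartesian_product diff_mult_distrib2)
qed

lemma card_trees_common_neighbour:
  assumes V: "finite V" "S \<subseteq> V" "S \<noteq> {}"
  shows "card {T \<in> trees_on V. \<exists>w. \<forall>s\<in>S. pendant T s w} = card (V - S) * card (trees_on (V - S))"
proof -
  let ?c = "\<lambda>w. \<lambda>s\<in>S. w"
  let ?F = "?c ` (V - S)"
  have "(\<exists>w. \<forall>s\<in>S. pendant T s w) \<longleftrightarrow> (\<exists>f\<in>?F. \<forall>s\<in>S. pendant T s (f s))" if T: "T \<in> trees_on V" for T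
  proof
    assume "\<exists>w. \<forall>s\<in>S. pendant T s w"
    then obtain w where w: "\<And>s. s \<in> S \<Longrightarrow> pendant T s w" by blast
    have "w \<in> V - S"
    proof
      obtain s where "s \<in> S" using V by blast
      then show "w \<in> V" using w edge_in_trees(2)[OF T pendantD] by blast
      show "w \<notin> S" using w edge_in_trees(3)[OF T pendantD[of T w w]] by blast
    qed
    then show "\<exists>f\<in>?F. \<forall>s\<in>S. pendant T s (f s)" using w by (intro bexI[of _ "?c w"]) auto
  qed auto
  then have "card {T \<in> trees_on V. \<exists>w. \<forall>s\<in>S. pendant T s w}
      = card {T \<in> trees_on V. \<exists>f\<in>?F. \<forall>s\<in>S. pendant T s (f s)}"
    by (intro arg_cong[of _ _ card] Collect_cong) auto
  also have "\<dots> = card ?F * card (trees_on (V - S))"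
    by (rule card_trees_pendant_family) (use V in auto)
  also have "card ?F = card (V - S)"
  proof (rule card_image[OF inj_onI])
    fix w w' assume eq: "?c w = ?c w'"
    obtain s where "s \<in> S" using V by blast
    then show "w = w'" using fun_cong[OF eq, of s] by simp
  qed
  finally show ?thesis .
qed

text \<open>
  The two common neighbours may coincide, hence the square.
\<close>

lemma card_trees_two_common_neighbours:
  assumes V: "finite V" "card V \<ge> 3" and S: "S \<subseteq> V" "S \<noteq> {}" and S': "S' \<subseteq> V" "S' \<noteq> {}"
    and disj: "S \<inter> S' = {}"
  shows "card {T \<in> trees_on V. (\<exists>w. \<forall>s\<in>S. pendant T s w) \<and> (\<exists>w. \<forall>s\<in>S'. pendant T s w)}
    = (card (V - (S \<union> S')))\<^sup>2 * card (trees_on (V - (S \<union> S')))"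
proof -
  let ?U = "S \<union> S'"
  let ?c = "\<lambda>p. \<lambda>s\<in>?U. if s \<in> S then fst p else snd p"
  let ?F = "?c ` ((V - ?U) \<times> (V - ?U))"
  have iff: "(\<exists>w. \<forall>s\<in>S. pendant T s w) \<and> (\<exists>w. \<forall>s\<in>S'. pendant T s w)
      \<longleftrightarrow> (\<exists>f\<in>?F. \<forall>s\<in>?U. pendant T s (f s))" if T: "T \<in> trees_on V" for T
  proof
    assume "(\<exists>w. \<forall>s\<in>S. pendant T s w) \<and> (\<exists>w. \<forall>s\<in>S'. pendant T s w)"
    then obtain w w' where w: "\<And>s. s \<in> S \<Longrightarrow> pendant T s w" "\<And>s. s \<in> S' \<Longrightarrow> pendant T s w'"
      by blast
    have outside: "x \<in> V - ?U" if "pendant T s x" for s x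
    proof
      show "x \<in> V" using edge_in_trees(2)[OF T pendantD[OF that]] .
      show "x \<notin> ?U" using w leaves_not_adjacent[OF T V(2) that] by blast
    qed
    obtain s s' where "s \<in> S" "s' \<in> S'" using S S' by blast
    then have "(w, w') \<in> (V - ?U) \<times> (V - ?U)" using w outside by blast
    moreover have "\<forall>s\<in>?U. pendant T s (?c (w, w') s)" using w by auto
    ultimately show "\<exists>f\<in>?F. \<forall>s\<in>?U. pendant T s (f s)" by blast
  next
    assume "\<exists>f\<in>?F. \<forall>s\<in>?U. pendant T s (f s)"
    then obtain p where p: "\<And>s. s \<in> ?U \<Longrightarrow> pendant T s (?c p s)" by auto
    have "\<forall>s\<in>S. pendant T s (fst p)" using p by fastforce
    moreover have "\<forall>s\<in>S'. pendant T s (snd p)"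
    proof
      fix s assume s: "s \<in> S'"
      then have "s \<notin> S" using disj by blast
      then show "pendant T s (snd p)" using p[of s] s by simp
    qed
    ultimately show "(\<exists>w. \<forall>s\<in>S. pendant T s w) \<and> (\<exists>w. \<forall>s\<in>S'. pendant T s w)" by blast
  qed
  have "card {T \<in> trees_on V. (\<exists>w. \<forall>s\<in>S. pendant T s w) \<and> (\<exists>w. \<forall>s\<in>S'. pendant T s w)}
      = card {T \<in> trees_on V. \<exists>f\<in>?F. \<forall>s\<in>?U. pendant T s (f s)}"
    by (intro arg_cong[of _ _ card] Collect_cong conj_cong refl iff)
  also have "\<dots> = card ?F * card (trees_on (V - ?U))"
  proof (rule card_trees_pendant_family[OF V(1)])
    show "?U \<subseteq> V" using S S' by blast
    show "?F \<subseteq> ?U \<rightarrow>\<^sub>E V - ?U"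
    proof (rule image_subsetI)
      fix p assume "p \<in> (V - ?U) \<times> (V - ?U)"
      then have "fst p \<in> V - ?U" "snd p \<in> V - ?U" by (simp_all add: mem_Times_iff)
      then show "?c p \<in> ?U \<rightarrow>\<^sub>E V - ?U" by (intro restrict_PiE_iff[THEN iffD2] ballI) simp
    qed
  qed
  also have "card ?F = card ((V - ?U) \<times> (V - ?U))"
  proof (rule card_image[OF inj_onI])
    fix p q assume eq: "?c p = ?c q"
    obtain s s' where s: "s \<in> S" "s' \<in> S'" "s' \<notin> S" using S S' disj by blast
    then show "p = q" using fun_cong[OF eq, of s] fun_cong[OF eq, of s'] by (simp add: prod_eq_iff)
  qed
  finally show ?thesis by (simp add: card_cartesian_product power2_eq_square)
qed

lemma card_trees_cayley:
  assumes "finite V" "S \<subseteq> V" "card S < card V"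
  shows "card (trees_on (V - S)) = (card V - card S) ^ (card V - card S - 2)"
proof -
  have card: "card (V - S) = card V - card S"
    using assms finite_subset by (intro card_Diff_subset) blast+
  have "card (V - S) > 0" using card assms(3) by simp
  then have "V - S \<noteq> {}" by (metis card.empty less_irrefl)
  then show ?thesis using cayley_formula[of "V - S"] assms(1) card by simp
qed

lemma card_trees_twins:
  assumes V: "finite V" "card V \<ge> 4" and p: "p \<in> off_diagonal V"
  shows "card {T \<in> trees_on V. twins T p} = (card V - 2) ^ (card V - 3)"
proof -
  let ?S = "{fst p, snd p}"
  have S: "?S \<subseteq> V" "card ?S = 2" using p by (auto simp: off_diagonal_def)
  have "{T \<in> trees_on V. twins T p} = {T \<in> trees_on V. \<exists>w. \<forall>s\<in>?S. pendant T s w}"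
    using p by (auto simp: twins_def off_diagonal_def)
  then have "card {T \<in> trees_on V. twins T p} = card (V - ?S) * card (trees_on (V - ?S))"
    using card_trees_common_neighbour[OF V(1) S(1)] by simp
  also have "\<dots> = (card V - 2) * (card V - 2) ^ (card V - 2 - 2)"
    using card_trees_cayley[OF V(1) S(1)] S V by (simp add: card_Diff_subset)
  also have "\<dots> = (card V - 2) ^ (card V - 3)"
    using V by (simp flip: power_Suc add: Suc_diff_le numeral_eq_Suc)
  finally show ?thesis .
qed

text \<open>
  Two overlapping pairs of twins are three leaves on one vertex.
\<close>

lemma card_trees_overlapping_twins:
  assumes V: "finite V" "card V \<ge> 5" and pq: "p \<in> off_diagonal V" "q \<in> off_diagonal V"
    and overlap: "card ({fst p, snd p} \<union> {fst q, snd q}) = 3"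
  shows "card {T \<in> trees_on V. twins T p \<and> twins T q} \<le> (card V - 3) ^ (card V - 4)"
proof -
  let ?S = "{fst p, snd p} \<union> {fst q, snd q}"
  have S: "?S \<subseteq> V" "?S \<noteq> {}" using pq by (auto simp: off_diagonal_def)
  have "{fst p, snd p} \<inter> {fst q, snd q} \<noteq> {}"
  proof
    assume "{fst p, snd p} \<inter> {fst q, snd q} = {}"
    then have "card ?S = card {fst p, snd p} + card {fst q, snd q}" by (intro card_Un_disjoint) auto
    then show False using pq overlap by (simp add: off_diagonal_def split: if_splits)
  qed
  then obtain t where t: "t \<in> {fst p, snd p}" "t \<in> {fst q, snd q}" by blast
  have "{T \<in> trees_on V. twins T p \<and> twins T q} \<subseteq> {T \<in> trees_on V. \<exists>w. \<forall>s\<in>?S. pendant T s w}"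
  proof clarify
    fix T assume "twins T p" "twins T q"
    then obtain w w' where w: "\<forall>s\<in>{fst p, snd p}. pendant T s w" "\<forall>s\<in>{fst q, snd q}. pendant T s w'"
      unfolding twins_def by blast
    then have "w = w'" using t pendant_unique[of T t w w'] by blast
    then have "\<forall>s\<in>?S. pendant T s w" using w by blast
    then show "\<exists>w. \<forall>s\<in>?S. pendant T s w" by blast
  qed
  then have "card {T \<in> trees_on V. twins T p \<and> twins T q} \<le> card {T \<in> trees_on V. \<exists>w. \<forall>s\<in>?S. pendant T s w}"
    using finite_trees[OF V(1)] by (intro card_mono) auto
  also have "\<dots> = card (V - ?S) * card (trees_on (V - ?S))"
    by (rule card_trees_common_neighbour[OF V(1) S])
  also have "\<dots> = (card V - 3) * (card V - 3) ^ (card V - 3 - 2)"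
    using card_trees_cayley[OF V(1) S(1)] card_Diff_subset[of ?S V] S overlap V by simp
  also have "\<dots> = (card V - 3) ^ (card V - 4)"
    using V by (simp flip: power_Suc add: Suc_diff_le numeral_eq_Suc)
  finally show ?thesis .
qed

lemma card_trees_disjoint_twins:
  assumes V: "finite V" "card V \<ge> 6" and pq: "p \<in> off_diagonal V" "q \<in> off_diagonal V"
    and disj: "{fst p, snd p} \<inter> {fst q, snd q} = {}"
  shows "card {T \<in> trees_on V. twins T p \<and> twins T q} = (card V - 4) ^ (card V - 4)"
proof -
  let ?P = "{fst p, snd p}" and ?Q = "{fst q, snd q}"
  have S: "?P \<union> ?Q \<subseteq> V" using pq by (auto simp: off_diagonal_def)
  have card: "card (?P \<union> ?Q) = 4"
    using pq card_Un_disjoint[OF _ _ disj] by (simp add: off_diagonal_def)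
  have "{T \<in> trees_on V. twins T p \<and> twins T q} =
      {T \<in> trees_on V. (\<exists>w. \<forall>s\<in>?P. pendant T s w) \<and> (\<exists>w. \<forall>s\<in>?Q. pendant T s w)}"
    using pq by (auto simp: twins_def off_diagonal_def)
  then have "card {T \<in> trees_on V. twins T p \<and> twins T q}
      = (card (V - (?P \<union> ?Q)))\<^sup>2 * card (trees_on (V - (?P \<union> ?Q)))"
    using card_trees_two_common_neighbours[OF V(1) _ _ _ _ _ disj] S V by simp
  also have "\<dots> = (card V - 4)\<^sup>2 * (card V - 4) ^ (card V - 4 - 2)"
    using card_trees_cayley[OF V(1) S] card_Diff_subset[of "?P \<union> ?Q" V] S card V by simp
  also have "\<dots> = (card V - 4) ^ (card V - 4)"
  proof -
    have "2 + (card V - 4 - 2) = card V - 4" using V(2) by simp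
    then show ?thesis by (metis power_add)
  qed
  finally show ?thesis .
qed


section \<open>Moments of the number of twin pairs\<close>

lemma sum_card_twin_pairs:
  assumes "finite V" "card V \<ge> 4"
  shows "(\<Sum>T\<in>trees_on V. card (twin_pairs V T)) = card V * (card V - 1) * (card V - 2) ^ (card V - 3)"
proof -
  have "(\<Sum>T\<in>trees_on V. card (twin_pairs V T)) = (\<Sum>p\<in>off_diagonal V. (card V - 2) ^ (card V - 3))"
    unfolding twin_pairs_def using assms finite_trees finite_off_diagonal card_trees_twins
    by (intro sum_multicount_gen) auto
  then show ?thesis by (simp add: card_off_diagonal assms)
qed

text \<open>
  For a fixed pair \<open>p\<close> there are two pairs on the same vertices, at most \<open>4 * (n - 2)\<close> pairs that
  share exactly one vertex with it, and \<open>(n - 2) * (n - 3)\<close> disjoint pairs. Only the last ones matter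
  asymptotically.
\<close>

lemma sum_card_common_twins_le:
  assumes V: "finite V" "card V \<ge> 6" and p: "p \<in> off_diagonal V"
  shows "(\<Sum>q\<in>off_diagonal V. card {T \<in> trees_on V. twins T p \<and> twins T q})
    \<le> 2 * (card V - 2) ^ (card V - 3) + 4 * (card V - 2) * (card V - 3) ^ (card V - 4)
      + (card V - 2) * (card V - 3) * (card V - 4) ^ (card V - 4)"
proof -
  let ?f = "\<lambda>q. card {T \<in> trees_on V. twins T p \<and> twins T q}"
  define S where "S = {fst p, snd p}"
  define W where "W = V - S"
  define A1 where "A1 = {p, prod.swap p}"
  define A2 where "A2 = S \<times> W \<union> W \<times> S"
  define A3 where "A3 = off_diagonal W"
  have S: "S \<subseteq> V" "card S = 2" "finite S" using p by (auto simp: S_def off_diagonal_def)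
  have W: "finite W" "card W = card V - 2"
    using S V by (auto simp: W_def card_Diff_subset)
  have fin: "finite A1" "finite A2" "finite A3"
    using S W by (auto simp: A1_def A2_def A3_def finite_off_diagonal)
  have sub: "A1 \<subseteq> off_diagonal V" "A2 \<subseteq> off_diagonal V" "A3 \<subseteq> off_diagonal V"
    using p S unfolding A1_def A2_def A3_def W_def S_def by (auto simp: off_diagonal_def)
  have cover: "off_diagonal V = A1 \<union> A2 \<union> A3"
  proof
    show "off_diagonal V \<subseteq> A1 \<union> A2 \<union> A3"
      unfolding A1_def A2_def A3_def W_def S_def
      by (cases p) (auto simp: off_diagonal_def)
  qed (use sub in blast)
  have f1: "?f q \<le> (card V - 2) ^ (card V - 3)" for q
  proof -
    have "?f q \<le> card {T \<in> trees_on V. twins T p}"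
      using finite_trees[OF V(1)] by (intro card_mono) auto
    also have "\<dots> = (card V - 2) ^ (card V - 3)" using card_trees_twins[OF V(1) _ p] V by simp
    finally show ?thesis .
  qed
  have f2: "?f q \<le> (card V - 3) ^ (card V - 4)" if q: "q \<in> A2" for q
  proof -
    obtain s t where t: "s \<in> S" "t \<notin> S" "q = (s, t) \<or> q = (t, s)"
      using q unfolding A2_def W_def by blast
    then have "{fst p, snd p} \<union> {fst q, snd q} = insert t S" by (auto simp: S_def)
    then have card: "card ({fst p, snd p} \<union> {fst q, snd q}) = 3" using S t by simp
    have "q \<in> off_diagonal V" using q sub(2) by blast
    then show ?thesis using V(2) by (intro card_trees_overlapping_twins[OF V(1) _ p _ card]) simp_all
  qed
  have f3: "?f q \<le> (card V - 4) ^ (card V - 4)" if q: "q \<in> A3" for q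
  proof -
    have "{fst p, snd p} \<inter> {fst q, snd q} = {}"
      using q unfolding A3_def W_def S_def by (auto simp: off_diagonal_def)
    moreover have "q \<in> off_diagonal V" using q sub(3) by blast
    ultimately show ?thesis by (simp add: card_trees_disjoint_twins[OF V p])
  qed
  have "sum ?f (off_diagonal V) \<le> sum ?f A1 + sum ?f A2 + sum ?f A3"
    using fin by (simp add: cover sum_Un_nat)
  also have "\<dots> \<le> card A1 * (card V - 2) ^ (card V - 3) + card A2 * (card V - 3) ^ (card V - 4)
      + card A3 * (card V - 4) ^ (card V - 4)"
    using sum_bounded_above[of A1 ?f, OF f1] sum_bounded_above[of A2 ?f, OF f2]
      sum_bounded_above[of A3 ?f, OF f3] by simp
  also have "\<dots> \<le> 2 * (card V - 2) ^ (card V - 3) + (4 * (card V - 2)) * (card V - 3) ^ (card V - 4)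
      + ((card V - 2) * (card V - 3)) * (card V - 4) ^ (card V - 4)"
  proof (intro add_mono mult_right_mono)
    show "card A1 \<le> 2" by (simp add: A1_def card_insert_if)
    show "card A2 \<le> 4 * (card V - 2)"
      unfolding A2_def by (rule order_trans[OF card_Un_le]) (simp add: card_cartesian_product S W)
    show "card A3 \<le> (card V - 2) * (card V - 3)"
      by (simp add: A3_def card_off_diagonal W)
  qed auto
  finally show ?thesis .
qed

lemma sum_card_twin_pairs_square_le:
  assumes V: "finite V" "card V \<ge> 6"
  shows "(\<Sum>T\<in>trees_on V. (card (twin_pairs V T))\<^sup>2) \<le> card V * (card V - 1) *
    (2 * (card V - 2) ^ (card V - 3) + 4 * (card V - 2) * (card V - 3) ^ (card V - 4)
      + (card V - 2) * (card V - 3) * (card V - 4) ^ (card V - 4))"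
proof -
  let ?P = "off_diagonal V"
  have "(card (twin_pairs V T))\<^sup>2 = card {r \<in> ?P \<times> ?P. twins T (fst r) \<and> twins T (snd r)}" for T
  proof -
    have "twin_pairs V T \<times> twin_pairs V T = {r \<in> ?P \<times> ?P. twins T (fst r) \<and> twins T (snd r)}"
      by (auto simp: twin_pairs_def)
    then show ?thesis by (metis card_cartesian_product power2_eq_square)
  qed
  then have "(\<Sum>T\<in>trees_on V. (card (twin_pairs V T))\<^sup>2)
      = (\<Sum>T\<in>trees_on V. card {r \<in> ?P \<times> ?P. twins T (fst r) \<and> twins T (snd r)})"
    by simp
  also have "\<dots> = (\<Sum>r\<in>?P \<times> ?P. card {T \<in> trees_on V. twins T (fst r) \<and> twins T (snd r)})"
    using V by (intro sum_multicount_gen finite_trees finite_cartesian_product finite_off_diagonal) auto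
  also have "\<dots> = (\<Sum>p\<in>?P. \<Sum>q\<in>?P. card {T \<in> trees_on V. twins T p \<and> twins T q})"
    by (simp add: sum.cartesian_product case_prod_unfold)
  also have "\<dots> \<le> of_nat (card ?P) *
    (2 * (card V - 2) ^ (card V - 3) + 4 * (card V - 2) * (card V - 3) ^ (card V - 4)
      + (card V - 2) * (card V - 3) * (card V - 4) ^ (card V - 4))"
    by (intro sum_bounded_above sum_card_common_twins_le[OF V])
  finally show ?thesis by (simp add: card_off_diagonal V)
qed

lemma chebyshev_counting:
  fixes X :: "'a \<Rightarrow> real" and \<mu> K :: real
  assumes A: "finite A" and mean: "(\<Sum>x\<in>A. X x) = card A * \<mu>" and K: "K \<le> \<mu>"
  shows "card {x \<in> A. X x \<le> K} * (\<mu> - K)\<^sup>2 \<le> (\<Sum>x\<in>A. (X x)\<^sup>2) - card A * \<mu>\<^sup>2"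
proof -
  have "card {x \<in> A. X x \<le> K} * (\<mu> - K)\<^sup>2 \<le> (\<Sum>x\<in>{x \<in> A. X x \<le> K}. (X x - \<mu>)\<^sup>2)"
  proof (rule sum_bounded_below)
    fix x assume "x \<in> {x \<in> A. X x \<le> K}"
    then have "(\<mu> - K)\<^sup>2 \<le> (\<mu> - X x)\<^sup>2" using K by (intro power_mono) auto
    then show "(\<mu> - K)\<^sup>2 \<le> (X x - \<mu>)\<^sup>2" by (simp add: power2_commute)
  qed
  also have "\<dots> \<le> (\<Sum>x\<in>A. (X x - \<mu>)\<^sup>2)"
    using A by (intro sum_mono2) auto
  also have "\<dots> = (\<Sum>x\<in>A. (X x)\<^sup>2) - 2 * \<mu> * (\<Sum>x\<in>A. X x) + card A * \<mu>\<^sup>2"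
    by (simp add: power2_diff sum.distrib sum_subtractf mult_ac
        flip: sum_distrib_left sum_distrib_right)
  also have "\<dots> = (\<Sum>x\<in>A. (X x)\<^sup>2) - card A * \<mu>\<^sup>2"
    by (simp add: mean power2_eq_square algebra_simps)
  finally show ?thesis .
qed

text \<open>
  The average number of ordered pairs of twins over all trees on \<open>x\<close> vertices, and an upper bound for the
  average of its square. The powers are written with \<open>powr\<close> so that the limits can be taken over the
  reals.
\<close>

definition twin_mean :: "real \<Rightarrow> real"
  where "twin_mean x = x * (x - 1) * (x - 2) powr (x - 3) / x powr (x - 2)"

definition twin_square_bound :: "real \<Rightarrow> real"
  where "twin_square_bound x = x * (x - 1) * (2 * (x - 2) powr (x - 3) + 4 * (x - 2) * (x - 3) powr (x - 4)
    + (x - 2) * (x - 3) * (x - 4) powr (x - 4)) / x powr (x - 2)"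

lemma twin_mean_at_top: "filterlim twin_mean at_top at_top"
  unfolding twin_mean_def by real_asymp

text \<open>
  Both terms of the numerator are asymptotic to the square of \<open>x / exp 2\<close>, so their leading parts
  cancel.
\<close>

lemma chebyshev_ratio_tendsto: "((\<lambda>x. (twin_square_bound x - (twin_mean x)\<^sup>2) / (twin_mean x - 9)\<^sup>2) \<longlongrightarrow> 0) at_top"
  unfolding twin_mean_def twin_square_bound_def by (real_asymp, simp add: exp_minus power2_eq_square)

lemma real_power_diff:
  assumes "j \<le> k" "k < n"
  shows "real ((n - j) ^ (n - k)) = (real n - real j) powr (real n - real k)"
proof -
  have "(real n - real j) powr (real n - real k) = (real n - real j) powr real (n - k)"
    using assms by (simp add: of_nat_diff)
  also have "\<dots> = (real n - real j) ^ (n - k)"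
    using assms by (intro powr_realpow) simp
  finally show ?thesis using assms by (simp add: of_nat_diff)
qed

lemma card_few_twin_pairs_le:
  assumes V: "finite V" "card V \<ge> 6" and large: "twin_mean (card V) > 9"
  shows "card {T \<in> trees_on V. card (twin_pairs V T) \<le> 9} / card (trees_on V)
    \<le> (twin_square_bound (card V) - (twin_mean (card V))\<^sup>2) / (twin_mean (card V) - 9)\<^sup>2"
proof -
  let ?n = "card V" and ?X = "\<lambda>T. real (card (twin_pairs V T))"
  define N where "N = real (card (trees_on V))"
  have "V \<noteq> {}" using V by auto
  then have N: "N = real ?n powr (real ?n - 2)"
    using cayley_formula[OF V(1)] real_power_diff[of 0 2 ?n] V by (simp add: N_def)
  have pos: "N > 0" using V(2) by (simp add: N powr_gt_zero flip: of_nat_0_less_iff)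
  have nat1: "real (?n - k) = real ?n - real k" if "k \<le> 6" for k
    using that V by (simp add: of_nat_diff)
  have pw: "real ((?n - j) ^ (?n - k)) = (real ?n - real j) powr (real ?n - real k)"
    if "j \<le> k" "k \<le> 5" for j k
    using that V by (intro real_power_diff) auto
  have mean: "(\<Sum>T\<in>trees_on V. ?X T) = card (trees_on V) * twin_mean ?n"
  proof -
    have "(\<Sum>T\<in>trees_on V. ?X T) = real (?n * (?n - 1) * (?n - 2) ^ (?n - 3))"
      using sum_card_twin_pairs[OF V(1)] V by (simp flip: of_nat_sum)
    also have "\<dots> = real ?n * (real ?n - 1) * (real ?n - 2) powr (real ?n - 3)"
      unfolding of_nat_mult using pw[of 2 3] nat1[of 1] by simp
    also have "\<dots> = N * twin_mean ?n" using pos by (simp add: twin_mean_def flip: N)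
    finally show ?thesis by (simp add: N_def)
  qed
  have square: "(\<Sum>T\<in>trees_on V. (?X T)\<^sup>2) \<le> N * twin_square_bound ?n"
  proof -
    have "(\<Sum>T\<in>trees_on V. (?X T)\<^sup>2) = real (\<Sum>T\<in>trees_on V. (card (twin_pairs V T))\<^sup>2)" by simp
    also have "\<dots> \<le> real (?n * (?n - 1) *
      (2 * (?n - 2) ^ (?n - 3) + 4 * (?n - 2) * (?n - 3) ^ (?n - 4)
      + (?n - 2) * (?n - 3) * (?n - 4) ^ (?n - 4)))"
      using sum_card_twin_pairs_square_le[OF V] by (simp only: of_nat_le_iff)
    also have "\<dots> = N * twin_square_bound ?n"
      unfolding of_nat_mult of_nat_add
      using pw[of 2 3] pw[of 3 4] pw[of 4 4] nat1[of 1] nat1[of 2] nat1[of 3] pos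
      by (simp add: twin_square_bound_def flip: N)
    finally show ?thesis .
  qed
  have "card {T \<in> trees_on V. ?X T \<le> 9} * (twin_mean ?n - 9)\<^sup>2 \<le> N * (twin_square_bound ?n - (twin_mean ?n)\<^sup>2)"
    using chebyshev_counting[OF finite_trees[OF V(1)] mean, of 9] square large
    by (simp add: N_def right_diff_distrib)
  moreover have "{T \<in> trees_on V. ?X T \<le> 9} = {T \<in> trees_on V. card (twin_pairs V T) \<le> 9}"
    by auto
  ultimately show ?thesis
    using pos large by (simp add: N_def field_simps)
qed

lemma twins_sym: "twins T (a, b) \<Longrightarrow> twins T (b, a)"
  by (auto simp: twins_def)

lemma twins_trans:
  assumes "twins T (a, b)" "twins T (b, c)" "a \<noteq> c" shows "twins T (a, c)"
proof -
  obtain w w' where w: "pendant T a w" "pendant T b w" "pendant T b w'" "pendant T c w'"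
    using assms by (auto simp: twins_def)
  then have "w = w'" using pendant_unique by blast
  then show ?thesis using w assms by (auto simp: twins_def)
qed

text \<open>
  Suppose that any two pairs of twins meet and fix one, \<open>{a, b}\<close>. If there is a third twin \<open>c\<close>, every
  pair of twins meets each of \<open>{a, b}\<close>, \<open>{a, c}\<close>, \<open>{b, c}\<close> and so lies in \<open>{a, b, c}\<close>; otherwise
  \<open>{a, b}\<close> is the only pair. Either way the ordered pairs lie in the square of a set with at most three
  elements. The crude bound nine is enough, as any constant would do.
\<close>

lemma disjoint_twins_if_many_twin_pairs:
  assumes V: "finite V" and many: "card (twin_pairs V T) > 9"
  obtains a b c d where "{a, b, c, d} \<subseteq> V" "distinct [a, b, c, d]" "twins T (a, b)" "twins T (c, d)"
proof (rule ccontr)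
  assume "\<not> thesis"
  note none = that this
  define R where "R x y \<longleftrightarrow> x \<in> V \<and> y \<in> V \<and> twins T (x, y)" for x y
  have R_neq: "x \<noteq> y" if "R x y" for x y using that by (simp add: R_def twins_def)
  have R_sym: "R y x" if "R x y" for x y using that twins_sym by (simp add: R_def)
  have R_trans: "R x z" if "R x y" "R y z" "x \<noteq> z" for x y z
    using that twins_trans[of T x y z] by (simp add: R_def)
  have meet: "x = u \<or> x = v \<or> y = u \<or> y = v" if uv: "R u v" and xy: "R x y" for u v x y
  proof (rule ccontr)
    assume "\<not> ?thesis"
    then have "distinct [u, v, x, y]" using R_neq[OF uv] R_neq[OF xy] by auto
    then show False using none(1)[of u v x y] none(2) uv xy by (simp add: R_def)
  qed
  have pairs: "twin_pairs V T = {(x, y). R x y}"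
    by (auto simp: twin_pairs_def off_diagonal_def twins_def R_def)
  have "twin_pairs V T \<noteq> {}" using many by auto
  then obtain a b where ab: "R a b" by (auto simp: pairs)
  have "\<exists>L. finite L \<and> card L \<le> 3 \<and> (\<forall>x y. R x y \<longrightarrow> x \<in> L \<and> y \<in> L)"
  proof (cases "\<exists>c. c \<noteq> b \<and> R a c")
    case True
    then obtain c where c: "c \<noteq> b" "R a c" by blast
    have bc: "R b c" using R_trans[OF R_sym[OF ab] c(2)] c(1) by simp
    have "x \<in> {a, b, c} \<and> y \<in> {a, b, c}" if "R x y" for x y
      using meet[OF ab that] meet[OF c(2) that] meet[OF bc that] R_neq[OF ab] R_neq[OF c(2)] c(1)
      by auto
    moreover have "card {a, b, c} \<le> 3" by (simp add: card_insert_if)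
    ultimately show ?thesis by (intro exI[of _ "{a, b, c}"]) blast
  next
    case False
    then have only_a: "c = b" if "R a c" for c using that by blast
    have only_b: "c = a" if "R b c" for c
      using only_a[of c] R_trans[OF ab that] R_neq[OF that] by blast
    have "x \<in> {a, b} \<and> y \<in> {a, b}" if "R x y" for x y
      using meet[OF ab that] only_a[of x] only_a[of y] only_b[of x] only_b[of y] that R_sym[OF that]
      by blast
    moreover have "card {a, b} \<le> 3" by (simp add: card_insert_if)
    ultimately show ?thesis by (intro exI[of _ "{a, b}"]) blast
  qed
  then obtain L where L: "finite L" "card L \<le> 3" "\<And>x y. R x y \<Longrightarrow> x \<in> L \<and> y \<in> L"
    by blast
  have "card (twin_pairs V T) \<le> card (L \<times> L)"
    using L by (intro card_mono) (auto simp: pairs)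
  also have "\<dots> \<le> 3 * 3"
    using L(2) by (simp only: card_cartesian_product mult_mono)
  finally show False using many by simp
qed

lemma twins_same_neighbours:
  assumes "twins T (a, b)" shows "{a, k} \<in> T \<longleftrightarrow> {b, k} \<in> T"
  using assms pendant_iff[of T a _ k] pendant_iff[of T b _ k] by (auto simp: twins_def)

lemma quantum_symmetry_if_many_twin_pairs:
  assumes "card (twin_pairs {1..n} T) > 9" shows "has_quantum_symmetry n T"
proof -
  obtain a b c d where "{a, b, c, d} \<subseteq> {1..n}" "distinct [a, b, c, d]"
      "twins T (a, b)" "twins T (c, d)"
    by (rule disjoint_twins_if_many_twin_pairs[OF finite_atLeastAtMost assms])
  then show ?thesis
    by (intro quantum_symmetry_of_disjoint_twins twins_same_neighbours)
qed

theorem theorem4p2: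
  shows "(\<lambda>n. measure_pmf.prob (pmf_of_set (labelled_trees n)) {T. has_quantum_symmetry n T})
    \<longlonglongrightarrow> 1"
proof (rule tendsto_sandwich)
  let ?P = "\<lambda>n. measure_pmf.prob (pmf_of_set (labelled_trees n)) {T. has_quantum_symmetry n T}"
  let ?r = "\<lambda>x. (twin_square_bound x - (twin_mean x)\<^sup>2) / (twin_mean x - 9)\<^sup>2"
  have "((\<lambda>n. ?r (real n)) \<longlongrightarrow> 0) sequentially"
    by (rule filterlim_compose[OF chebyshev_ratio_tendsto filterlim_real_sequentially])
  then have "((\<lambda>n. 1 - ?r (real n)) \<longlongrightarrow> 1 - 0) sequentially"
    by (intro tendsto_intros)
  then show "(\<lambda>n. 1 - ?r (real n)) \<longlonglongrightarrow> 1" by simp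
  have "\<forall>\<^sub>F n in sequentially. twin_mean (real n) > 9"
    using filterlim_compose[OF twin_mean_at_top filterlim_real_sequentially]
    by (simp add: filterlim_at_top_dense)
  then show "\<forall>\<^sub>F n in sequentially. 1 - ?r (real n) \<le> ?P n"
    using eventually_ge_at_top[of 6]
  proof eventually_elim
    case (elim n)
    let ?A = "trees_on {1..n}"
    let ?few = "{T \<in> ?A. card (twin_pairs {1..n} T) \<le> 9}"
    let ?Q = "{T. has_quantum_symmetry n T}"
    have fin: "finite ?A" by (simp add: finite_trees)
    have card: "card ?A > 0" using cayley_formula[of "{1..n}"] elim by simp
    have "?A - ?few \<subseteq> ?A \<inter> ?Q"
    proof
      fix T assume T: "T \<in> ?A - ?few"
      then have "card (twin_pairs {1..n} T) > 9" by auto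
      then show "T \<in> ?A \<inter> ?Q" using T quantum_symmetry_if_many_twin_pairs by blast
    qed
    then have "card (?A - ?few) \<le> card (?A \<inter> ?Q)" using fin by (intro card_mono) auto
    then have "real (card ?A) - real (card ?few) \<le> real (card (?A \<inter> ?Q))"
      using fin by (simp add: card_Diff_subset)
    then have "(real (card ?A) - real (card ?few)) / card ?A \<le> card (?A \<inter> ?Q) / card ?A"
      by (rule divide_right_mono) simp
    then have "1 - card ?few / card ?A \<le> card (?A \<inter> ?Q) / card ?A"
      using card by (simp add: diff_divide_distrib)
    moreover have "?P n = card (?A \<inter> ?Q) / card ?A"
      unfolding labelled_trees_eq using fin card by (intro measure_pmf_of_set) auto
    ultimately show ?case using card_few_twin_pairs_le[of "{1..n}"] elim by simp
  qed
  show "\<forall>\<^sub>F n in sequentially. ?P n \<le> 1" by simp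
qed simp

end
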